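(* Let $n\ge 2$ and let $m=r^n(n-1)+1$, where $r>1$ is an integer coprime to $n-1$. Then there exists an injective homomorphism $\mathrm{Out}(F_n)\hookrightarrow\mathrm{Out}(F_m)$.
   Context: $F_k$ denotes the free group of rank $k$ and $\mathrm{Out}(F_k)=\mathrm{Aut}(F_k)/\mathrm{Inn}(F_k)$. *)

theory Defs
  imports "HOL-Algebra.Bij" "HOL-Algebra.Coset"
begin

section \<open>Free groups\<close>

text \<open>
  A letter \<open>(x, True)\<close> stands for the generator \<open>x\<close>, and \<open>(x, False)\<close> for its formal inverse.
  The free group on \<open>S\<close> is the group of reduced words over \<open>S\<close>; the product is concatenation
  followed by free reduction. Its universal property is proved in \<open>free_group_universal\<close>.
\<close>

type_synonym 'a letter = "'a \<times> bool"

definition inv_letter :: "'a letter \<Rightarrow> 'a letter"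
  where "inv_letter a = (fst a, \<not> snd a)"

definition reduced :: "'a letter list \<Rightarrow> bool"
  where "reduced w \<longleftrightarrow> successively (\<lambda>a b. b \<noteq> inv_letter a) w"

fun cons_reduce :: "'a letter \<Rightarrow> 'a letter list \<Rightarrow> 'a letter list"
  where
    "cons_reduce a [] = [a]"
  | "cons_reduce a (b # w) = (if b = inv_letter a then w else a # b # w)"

definition free_group :: "'a set \<Rightarrow> 'a letter list monoid"
  where "free_group S =
    \<lparr>carrier = {w. reduced w \<and> fst ` set w \<subseteq> S},
     mult = (\<lambda>u v. foldr cons_reduce u v),
     one = []\<rparr>"

lemma inv_letter_inv_letter [simp]: "inv_letter (inv_letter a) = a"
  by (simp add: inv_letter_def)

lemma inv_letter_neq [simp]: "inv_letter a \<noteq> a" "a \<noteq> inv_letter a"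
  by (cases a; simp add: inv_letter_def)+

lemma fst_inv_letter [simp]: "fst (inv_letter a) = fst a"
  by (simp add: inv_letter_def)

lemma reduced_Nil [simp]: "reduced []"
  by (simp add: reduced_def)

lemma reduced_ConsD: "reduced (a # w) \<Longrightarrow> reduced w"
  by (cases w) (auto simp: reduced_def)

lemma reduced_cons_reduce: "reduced w \<Longrightarrow> reduced (cons_reduce a w)"
  by (cases w) (auto simp: reduced_def successively_Cons)

lemma cons_reduce_eq_Cons: "reduced (a # w) \<Longrightarrow> cons_reduce a w = a # w"
  by (cases w) (auto simp: reduced_def)

lemma cons_reduce_inv_letter:
  "reduced w \<Longrightarrow> cons_reduce a (cons_reduce (inv_letter a) w) = w"
  by (cases w) (auto simp: cons_reduce_eq_Cons)

lemma set_cons_reduce: "set (cons_reduce a w) \<subseteq> insert a (set w)"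
  by (cases w) auto

lemma reduced_foldr: "reduced v \<Longrightarrow> reduced (foldr cons_reduce u v)"
  by (induction u) (auto intro: reduced_cons_reduce)

lemma set_foldr: "set (foldr cons_reduce u v) \<subseteq> set u \<union> set v"
  by (induction u) (use set_cons_reduce in fastforce)+

lemma foldr_cons_reduce:
  assumes "reduced v"
  shows "foldr cons_reduce (cons_reduce a u) v = cons_reduce a (foldr cons_reduce u v)"
  using assms by (cases u) (auto simp: cons_reduce_inv_letter reduced_foldr)

lemma foldr_assoc:
  assumes "reduced w"
  shows "foldr cons_reduce (foldr cons_reduce u v) w = foldr cons_reduce u (foldr cons_reduce v w)"
  by (induction u) (simp_all add: foldr_cons_reduce assms)

lemma foldr_Nil: "reduced u \<Longrightarrow> foldr cons_reduce u [] = u"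
  by (induction u) (use reduced_ConsD cons_reduce_eq_Cons in fastforce)+

lemma foldr_inv: "foldr cons_reduce (rev (map inv_letter u)) u = []"
  by (induction u) simp_all

lemma reduced_rev_map_inv_letter:
  assumes "reduced u"
  shows "reduced (rev (map inv_letter u))"
proof -
  have "successively (\<lambda>a b. inv_letter a \<noteq> b) u"
    using assms unfolding reduced_def by (rule successively_mono) auto
  then show ?thesis
    by (simp add: reduced_def successively_map)
qed

theorem group_free_group: "group (free_group S)"
proof (rule groupI)
  fix u v w
  assume u: "u \<in> carrier (free_group S)" and v: "v \<in> carrier (free_group S)"
  show "u \<otimes>\<^bsub>free_group S\<^esub> v \<in> carrier (free_group S)"
    using u v set_foldr[of u v] by (fastforce simp: free_group_def reduced_foldr)
  show "u \<otimes>\<^bsub>free_group S\<^esub> v \<otimes>\<^bsub>free_group S\<^esub> w = u \<otimes>\<^bsub>free_group S\<^esub> (v \<otimes>\<^bsub>free_group S\<^esub> w)"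
    if "w \<in> carrier (free_group S)"
    using that by (simp add: free_group_def foldr_assoc)
next
  fix u
  assume u: "u \<in> carrier (free_group S)"
  show "\<exists>v\<in>carrier (free_group S). v \<otimes>\<^bsub>free_group S\<^esub> u = \<one>\<^bsub>free_group S\<^esub>"
    using u by (intro bexI[of _ "rev (map inv_letter u)"])
      (auto simp: free_group_def foldr_inv reduced_rev_map_inv_letter)
qed (auto simp: free_group_def)

context group
begin

definition word_value :: "('c \<Rightarrow> 'a) \<Rightarrow> 'c letter list \<Rightarrow> 'a"
  where "word_value f w = foldr (\<lambda>a g. (if snd a then f (fst a) else inv (f (fst a))) \<otimes> g) w \<one>"

lemma word_value_closed:
  assumes "f \<in> S \<rightarrow> carrier G" "fst ` set w \<subseteq> S"
  shows "word_value f w \<in> carrier G"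
  using assms(2) by (induction w) (use assms(1) in \<open>auto simp: word_value_def Pi_iff\<close>)

lemma word_value_cons_reduce:
  assumes "f \<in> S \<rightarrow> carrier G" "fst a \<in> S" "fst ` set w \<subseteq> S"
  shows "word_value f (cons_reduce a w) = word_value f [a] \<otimes> word_value f w"
proof (cases w)
  case Nil
  then show ?thesis
    using word_value_closed[OF assms(1), of "[a]"] assms(2) by (simp add: word_value_def)
next
  case (Cons b v)
  have *: "word_value f v \<in> carrier G" "word_value f w \<in> carrier G" "f (fst a) \<in> carrier G"
    using assms Cons word_value_closed[OF assms(1), of v] word_value_closed[OF assms(1), of w]
    by (auto simp: Pi_iff)
  then show ?thesis
    using Cons by (auto simp: word_value_def inv_letter_def m_assoc[symmetric])
qed

lemma word_value_foldr:
  assumes "f \<in> S \<rightarrow> carrier G" "fst ` set u \<subseteq> S" "fst ` set v \<subseteq> S"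
  shows "word_value f (foldr cons_reduce u v) = word_value f u \<otimes> word_value f v"
  using assms(2)
proof (induction u)
  case Nil
  then show ?case
    using word_value_closed[OF assms(1,3)] by (simp add: word_value_def)
next
  case (Cons a u)
  have "fst ` set (foldr cons_reduce u v) \<subseteq> S"
    using set_foldr[of u v] Cons.prems assms(3) by fastforce
  then have "word_value f (foldr cons_reduce (a # u) v)
      = word_value f [a] \<otimes> (word_value f u \<otimes> word_value f v)"
    using Cons word_value_cons_reduce[OF assms(1), of a "foldr cons_reduce u v"] by simp
  moreover have "word_value f (a # u) = word_value f [a] \<otimes> word_value f u"
    using Cons.prems assms(1) by (auto simp: word_value_def Pi_iff)
  moreover have "word_value f [a] \<in> carrier G" "word_value f u \<in> carrier G"
      "word_value f v \<in> carrier G"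
    using Cons.prems assms(3) by (auto intro!: word_value_closed[OF assms(1)])
  ultimately show ?case
    by (simp add: m_assoc)
qed

theorem free_group_universal:
  assumes f: "f \<in> S \<rightarrow> carrier G"
  shows "\<exists>!h. h \<in> hom (free_group S) G \<inter> extensional (carrier (free_group S))
              \<and> (\<forall>x\<in>S. h [(x, True)] = f x)"
proof (rule ex_ex1I)
  interpret F: group "free_group S" by (rule group_free_group)
  let ?h = "restrict (word_value f) (carrier (free_group S))"
  have "?h \<in> hom (free_group S) G"
  proof (rule homI)
    fix u v assume uv: "u \<in> carrier (free_group S)" "v \<in> carrier (free_group S)"
    then show "?h u \<in> carrier G"
      by (auto simp: free_group_def intro!: word_value_closed[OF f])
    show "?h (u \<otimes>\<^bsub>free_group S\<^esub> v) = ?h u \<otimes> ?h v"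
      using uv F.m_closed[OF uv] word_value_foldr[OF f, of u v] by (simp add: free_group_def)
  qed
  then show "\<exists>h. h \<in> hom (free_group S) G \<inter> extensional (carrier (free_group S))
              \<and> (\<forall>x\<in>S. h [(x, True)] = f x)"
    using f by (intro exI[of _ ?h]) (auto simp: free_group_def reduced_def word_value_def Pi_iff)
next
  interpret F: group "free_group S" by (rule group_free_group)
  fix h k
  assume h: "h \<in> hom (free_group S) G \<inter> extensional (carrier (free_group S))
              \<and> (\<forall>x\<in>S. h [(x, True)] = f x)"
    and k: "k \<in> hom (free_group S) G \<inter> extensional (carrier (free_group S))
              \<and> (\<forall>x\<in>S. k [(x, True)] = f x)"
  interpret h: group_hom "free_group S" G h
    using h by unfold_locales auto
  interpret k: group_hom "free_group S" G k
    using k by unfold_locales auto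
  have inv: "inv\<^bsub>free_group S\<^esub> [(x, True)] = [(x, False)]" if "x \<in> S" for x
    using that by (intro F.inv_equality) (auto simp: free_group_def reduced_def inv_letter_def)
  have gen: "[(x, b)] \<in> carrier (free_group S)" if "x \<in> S" for x b
    using that by (simp add: free_group_def reduced_def)
  have letter: "h [(x, b)] = k [(x, b)]" if "x \<in> S" for x b
    using h k h.hom_inv[OF gen[OF that, of True]] k.hom_inv[OF gen[OF that, of True]]
    by (cases b) (auto simp: inv that)
  have "h w = k w" if "w \<in> carrier (free_group S)" for w
    using that
  proof (induction w)
    case Nil
    then show ?case
      using h.hom_one k.hom_one by (simp add: free_group_def)
  next
    case (Cons a w)
    obtain x b where a: "a = (x, b)" by (cases a)
    have x: "x \<in> S" and w: "w \<in> carrier (free_group S)" and red: "reduced (a # w)"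
      using Cons.prems a by (auto simp: free_group_def dest: reduced_ConsD)
    have eq: "a # w = [(x, b)] \<otimes>\<^bsub>free_group S\<^esub> w"
      using cons_reduce_eq_Cons[OF red] by (simp add: free_group_def a)
    show ?case
      unfolding eq using gen[OF x, of b] w Cons.IH[OF w] letter[OF x, of b] by simp
  qed
  then show "h = k"
    using h k by (intro extensionalityI[of _ "carrier (free_group S)"]) auto
qed

end


section \<open>Outer automorphism groups\<close>

definition Inn :: "('a, 'b) monoid_scheme \<Rightarrow> ('a \<Rightarrow> 'a) set"
  where "Inn G = {(\<lambda>x\<in>carrier G. g \<otimes>\<^bsub>G\<^esub> x \<otimes>\<^bsub>G\<^esub> inv\<^bsub>G\<^esub> g) | g. g \<in> carrier G}"

definition Out :: "('a, 'b) monoid_scheme \<Rightarrow> ('a \<Rightarrow> 'a) set monoid"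
  where "Out G = AutoGroup G Mod Inn G"

lemma carrier_AutoGroup [simp]: "carrier (AutoGroup G) = auto G"
  by (simp add: AutoGroup_def)

lemma mult_AutoGroup:
  "\<lbrakk>f \<in> auto G; g \<in> auto G\<rbrakk> \<Longrightarrow> f \<otimes>\<^bsub>AutoGroup G\<^esub> g = compose (carrier G) f g"
  by (simp add: AutoGroup_def BijGroup_def auto_def)

lemma one_AutoGroup: "\<one>\<^bsub>AutoGroup G\<^esub> = (\<lambda>x\<in>carrier G. x)"
  by (simp add: AutoGroup_def BijGroup_def)

context group
begin

abbreviation conj_by :: "'a \<Rightarrow> 'a \<Rightarrow> 'a"
  where "conj_by g \<equiv> (\<lambda>x\<in>carrier G. g \<otimes> x \<otimes> inv g)"

lemma compose_conj_by:
  assumes "g \<in> carrier G" "h \<in> carrier G"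
  shows "compose (carrier G) (conj_by g) (conj_by h) = conj_by (g \<otimes> h)"
  using assms by (auto simp: compose_def fun_eq_iff inv_mult_group m_assoc)

lemma conj_by_one: "conj_by \<one> = (\<lambda>x\<in>carrier G. x)"
  by (auto simp: fun_eq_iff)

lemma conj_by_auto:
  assumes g: "g \<in> carrier G"
  shows "conj_by g \<in> auto G"
proof -
  have *: "g \<otimes> (inv g \<otimes> x) = x" "inv g \<otimes> (g \<otimes> x) = x" if "x \<in> carrier G" for x
    using g that by (simp_all add: m_assoc[symmetric])
  have "bij_betw (conj_by g) (carrier G) (carrier G)"
    by (rule bij_betw_byWitness[where f' = "conj_by (inv g)"]) (use g in \<open>auto simp: m_assoc *\<close>)
  moreover have "conj_by g \<in> hom G G"
    using g by (intro homI) (auto simp: m_assoc *)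
  ultimately show ?thesis
    by (simp add: auto_def Bij_def)
qed

theorem normal_Inn: "Inn G \<lhd> AutoGroup G"
proof -
  interpret A: group "AutoGroup G" by (rule AutoGroup)
  have sub: "subgroup (Inn G) (AutoGroup G)"
  proof (rule A.subgroupI)
    show "Inn G \<subseteq> carrier (AutoGroup G)"
      by (auto simp: Inn_def simp del: restrict_apply intro: conj_by_auto)
    show "Inn G \<noteq> {}"
      by (auto simp: Inn_def)
    fix a assume "a \<in> Inn G"
    then obtain g where g: "g \<in> carrier G" "a = conj_by g"
      by (auto simp: Inn_def)
    have "inv\<^bsub>AutoGroup G\<^esub> a = conj_by (inv g)"
      using g conj_by_auto[of "inv g"] conj_by_auto[of g] compose_conj_by[of "inv g" g] conj_by_one
      by (intro A.inv_equality)
        (simp_all add: mult_AutoGroup one_AutoGroup del: restrict_apply inv_inv)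
    then show "inv\<^bsub>AutoGroup G\<^esub> a \<in> Inn G"
      using inv_closed[OF g(1)] unfolding Inn_def by blast
    fix b assume "b \<in> Inn G"
    then obtain h where h: "h \<in> carrier G" "b = conj_by h"
      by (auto simp: Inn_def)
    have "a \<otimes>\<^bsub>AutoGroup G\<^esub> b = conj_by (g \<otimes> h)"
      using g h by (simp add: mult_AutoGroup conj_by_auto compose_conj_by del: restrict_apply)
    then show "a \<otimes>\<^bsub>AutoGroup G\<^esub> b \<in> Inn G"
      using g h by (auto simp: Inn_def)
  qed
  show ?thesis
    unfolding A.normal_inv_iff
  proof (intro conjI sub ballI)
    fix f a assume f: "f \<in> carrier (AutoGroup G)" and "a \<in> Inn G"
    then obtain g where g: "g \<in> carrier G" "a = conj_by g"
      by (auto simp: Inn_def)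
    interpret f: group_hom G G f
      using f by unfold_locales (simp add: auto_def)
    have fa: "f \<in> auto G" and aa: "a \<in> auto G" and ca: "conj_by (f g) \<in> auto G"
      using f g by (simp_all add: conj_by_auto del: restrict_apply)
    have "compose (carrier G) f a = compose (carrier G) (conj_by (f g)) f"
      using g by (auto simp: compose_def fun_eq_iff)
    then have "f \<otimes>\<^bsub>AutoGroup G\<^esub> a = conj_by (f g) \<otimes>\<^bsub>AutoGroup G\<^esub> f"
      using mult_AutoGroup fa aa ca by metis
    then have "f \<otimes>\<^bsub>AutoGroup G\<^esub> a \<otimes>\<^bsub>AutoGroup G\<^esub> inv\<^bsub>AutoGroup G\<^esub> f = conj_by (f g)"
      using A.inv_solve_right'[of "conj_by (f g)" "f \<otimes>\<^bsub>AutoGroup G\<^esub> a" f] fa aa ca A.m_closed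
      by simp
    then show "f \<otimes>\<^bsub>AutoGroup G\<^esub> a \<otimes>\<^bsub>AutoGroup G\<^esub> inv\<^bsub>AutoGroup G\<^esub> f \<in> Inn G"
      using g by (auto simp: Inn_def)
  qed
qed

theorem group_Out: "group (Out G)"
  unfolding Out_def by (rule normal.factorgroup_is_group[OF normal_Inn])

end

end

theory Submission
  imports Defs
begin

text \<open>
  Write \<open>F\<close> for the free group of rank \<open>n\<close>, \<open>H\<close> for its abelianization \<open>\<int>\<^sup>n\<close>, and let \<open>N\<close> be the
  kernel of \<open>F \<rightarrow> H / r H\<close>. It is the fundamental group of the cover of the rose with \<open>n\<close> petals
  whose deck group is \<open>H / r H\<close>, so counting edges outside a spanning tree shows that \<open>N\<close> is free of
  rank \<open>r ^ n * (n - 1) + 1 = m\<close> (\<open>stabilizer_free\<close>, \<open>N_free\<close>). Since \<open>N\<close> is characteristic, every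
  automorphism of \<open>F\<close> restricts to \<open>N\<close>, but an inner automorphism of \<open>F\<close> by an element outside \<open>N\<close>
  need not become inner. So restriction does not descend to \<open>Out F\<close> directly: what is needed is a
  subgroup \<open>K\<close> of \<open>Aut F\<close> that meets every outer class and contains conjugation by \<open>g\<close> only when
  \<open>g \<in> N\<close>. Given such a \<open>K\<close>, an outer class can be represented in \<open>K\<close>, uniquely up to
  conjugation by \<open>N\<close>, and then restricted (\<open>Out_embeds_if_splitting_over_subgroup\<close>). The resulting map
  is injective: an automorphism \<open>\<phi>\<close> that fixes \<open>N\<close> pointwise satisfies \<open>\<phi> (x y x\<inverse>) = x y x\<inverse>\<close> for
  \<open>y \<in> N\<close>, hence \<open>x\<inverse> \<phi>(x)\<close> centralizes \<open>N\<close>, and the centralizer of \<open>N\<close> is trivial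
  (\<open>centralizer_N_trivial\<close>).

  The subgroup \<open>K\<close> comes from a crossed homomorphism \<open>\<kappa> : Aut F \<rightarrow> H\<close> with
  \<open>\<kappa>(conjugation by g) = (n - 1) [g]\<close>. It is Morita's trace cocycle: the second-order part of the
  Magnus expansion measures how far \<open>\<phi>\<close> is from acting on \<open>H \<otimes> H\<close> through its action on \<open>H\<close>. The
  discrepancy is a cocycle with values in \<open>Hom(H, H \<otimes> H)\<close>, and contracting it gives \<open>\<kappa>\<close>
  (\<open>trace_cocycle_compose\<close>, \<open>trace_cocycle_conj\<close>). Let \<open>K\<close> be the set of \<open>\<phi>\<close> with
  \<open>\<kappa>(\<phi>) \<in> r H\<close>. When \<open>n - 1\<close> is invertible modulo \<open>r\<close>, composing \<open>\<phi>\<close> with a suitable conjugation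
  makes \<open>\<kappa>\<close> vanish modulo \<open>r\<close>, so \<open>K\<close> meets every outer class
  (\<open>K_meets_every_outer_class\<close>); and \<open>(n - 1) [g] \<in> r H\<close> forces \<open>[g] \<in> r H\<close>, that is \<open>g \<in> N\<close>
  (\<open>inner_in_K\<close>).
\<close>

section \<open>Embedding outer automorphism groups by restriction to a subgroup\<close>

text \<open>
  A map out of \<open>A\<close> is obtained by lifting along \<open>p\<close> to \<open>K\<close> and applying \<open>q\<close>; equality of the kernels
  makes it well defined and injective at once.
\<close>

lemma hom_factor_inj:
  assumes "group K" "group A" "group B"
    and p: "p \<in> hom K A" and surj: "p ` carrier K = carrier A" and q: "q \<in> hom K B"
    and ker: "\<And>k. k \<in> carrier K \<Longrightarrow> p k = \<one>\<^bsub>A\<^esub> \<longleftrightarrow> q k = \<one>\<^bsub>B\<^esub>"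
  shows "\<exists>h. h \<in> hom A B \<and> inj_on h (carrier A)"
proof -
  interpret K: group K by fact
  interpret A: group A by fact
  interpret B: group B by fact
  interpret p: group_hom K A p using p by unfold_locales
  interpret q: group_hom K B q using q by unfold_locales
  have same: "p x = p y \<longleftrightarrow> q x = q y" if "x \<in> carrier K" "y \<in> carrier K" for x y
  proof -
    have "p x = p y \<longleftrightarrow> p (x \<otimes>\<^bsub>K\<^esub> inv\<^bsub>K\<^esub> y) = \<one>\<^bsub>A\<^esub>"
      using that by (simp add: A.inv_solve_right')
    also have "\<dots> \<longleftrightarrow> q (x \<otimes>\<^bsub>K\<^esub> inv\<^bsub>K\<^esub> y) = \<one>\<^bsub>B\<^esub>"
      using that by (intro ker) simp
    also have "\<dots> \<longleftrightarrow> q x = q y"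
      using that by (simp add: B.inv_solve_right')
    finally show ?thesis .
  qed
  define s where "s = inv_into (carrier K) p"
  have s: "s a \<in> carrier K" "p (s a) = a" if "a \<in> carrier A" for a
    using that surj unfolding s_def by (auto intro: inv_into_into f_inv_into_f)
  have "(\<lambda>a. q (s a)) \<in> hom A B"
  proof (rule homI)
    fix a b assume ab: "a \<in> carrier A" "b \<in> carrier A"
    show "q (s a) \<in> carrier B" using s ab by simp
    have "q (s (a \<otimes>\<^bsub>A\<^esub> b)) = q (s a \<otimes>\<^bsub>K\<^esub> s b)"
      using s ab by (subst same[symmetric]) auto
    then show "q (s (a \<otimes>\<^bsub>A\<^esub> b)) = q (s a) \<otimes>\<^bsub>B\<^esub> q (s b)"
      using s ab by simp
  qed
  moreover have "inj_on (\<lambda>a. q (s a)) (carrier A)"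
    by (rule inj_onI) (metis s same)
  ultimately show ?thesis by blast
qed

lemma autoD:
  assumes "\<phi> \<in> auto G"
  shows "\<phi> \<in> hom G G" "bij_betw \<phi> (carrier G) (carrier G)" "\<phi> \<in> extensional (carrier G)"
  using assms by (auto simp: auto_def Bij_def)

lemma (in group) Mod_coset_eq_one_iff:
  assumes "H \<lhd> G" "a \<in> carrier G"
  shows "H #> a = \<one>\<^bsub>G Mod H\<^esub> \<longleftrightarrow> a \<in> H"
  using assms rcos_self[OF assms(2)] coset_join2[OF assms(2)]
  by (auto simp: FactGroup_def normal_imp_subgroup)

text \<open>
  \<open>K\<close> plays the role of a splitting of the extension of \<open>Out G\<close> by \<open>G / N\<close>, where \<open>N\<close> is the image of
  \<open>i\<close>: projection from \<open>K\<close> to \<open>Out G\<close> is onto by \<open>meets\<close>, and restriction to \<open>N\<close> maps \<open>K\<close> to \<open>Out M\<close>.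
  Both homomorphisms have kernel \<open>K \<inter> Inn G\<close>, the first by definition, the second by \<open>inner\<close> and
  \<open>centralizer\<close>, so one factors through the other.
\<close>

lemma (in group) Out_embeds_if_splitting_over_subgroup:
  fixes M :: "('m, 'n) monoid_scheme"
  assumes M: "group M" and i: "i \<in> hom M G" and inj: "inj_on i (carrier M)"
    and K: "subgroup K (AutoGroup G)"
    and norm: "i ` carrier M \<lhd> G"
    and stable: "\<And>\<phi>. \<phi> \<in> K \<Longrightarrow> \<phi> ` (i ` carrier M) = i ` carrier M"
    and meets: "\<And>\<phi>. \<phi> \<in> auto G \<Longrightarrow> \<exists>g\<in>carrier G. compose (carrier G) (conj_by g) \<phi> \<in> K"
    and inner: "\<And>g. g \<in> carrier G \<Longrightarrow> conj_by g \<in> K \<Longrightarrow> g \<in> i ` carrier M"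
    and centralizer: "\<And>g. g \<in> carrier G \<Longrightarrow> (\<And>x. x \<in> i ` carrier M \<Longrightarrow> g \<otimes> x = x \<otimes> g) \<Longrightarrow> g = \<one>"
  shows "\<exists>h. h \<in> hom (Out G) (Out M) \<and> inj_on h (carrier (Out G))"
proof -
  interpret M: group M by fact
  interpret i: group_hom M G i using i by unfold_locales
  interpret A: group "AutoGroup G" by (rule AutoGroup)
  interpret B: group "AutoGroup M" by (rule M.AutoGroup)
  define N where "N = i ` carrier M"
  interpret N: normal N G using norm by (simp add: N_def)
  have Nsub: "N \<subseteq> carrier G" by (rule N.subset)
  have Kauto: "\<phi> \<in> auto G" if "\<phi> \<in> K" for \<phi>
    using subgroup.mem_carrier[OF K that] by simp
  define j where "j = inv_into (carrier M) i"
  have j: "j y \<in> carrier M" "i (j y) = y" if "y \<in> N" for y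
    using that unfolding j_def N_def by (auto intro: inv_into_into f_inv_into_f)
  have ji: "j (i x) = x" if "x \<in> carrier M" for x
    using that inj by (simp add: j_def)
  have iN: "i x \<in> N" if "x \<in> carrier M" for x using that by (simp add: N_def)
  have KN: "\<phi> y \<in> N" if "\<phi> \<in> K" "y \<in> N" for \<phi> y
    using stable[OF that(1)] that(2) by (auto simp: N_def)
  have jmult: "j (x \<otimes> y) = j x \<otimes>\<^bsub>M\<^esub> j y" if "x \<in> N" "y \<in> N" for x y
    using that j by (intro inj_onD[OF inj]) auto
  define res where "res \<phi> = (\<lambda>x\<in>carrier M. j (\<phi> (i x)))" for \<phi>
  have res_auto: "res \<phi> \<in> auto M" if \<phi>: "\<phi> \<in> K" for \<phi>
  proof -
    note a = autoD[OF Kauto[OF \<phi>]]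
    have "bij_betw i (carrier M) N" using inj by (simp add: N_def bij_betw_def)
    moreover have "bij_betw \<phi> N N"
      using a(2) Nsub stable[OF \<phi>] by (auto simp: bij_betw_def N_def intro: inj_on_subset)
    moreover have "bij_betw j N (carrier M)"
      unfolding j_def N_def by (rule bij_betw_inv_into) (use inj in \<open>simp add: bij_betw_def\<close>)
    ultimately have "bij_betw (j \<circ> (\<phi> \<circ> i)) (carrier M) (carrier M)"
      by (meson bij_betw_trans)
    then have "bij_betw (res \<phi>) (carrier M) (carrier M)"
      by (rule bij_betw_cong[THEN iffD1, rotated]) (simp add: res_def)
    moreover have "res \<phi> \<in> hom M M"
    proof (rule homI)
      fix x y assume xy: "x \<in> carrier M" "y \<in> carrier M"
      show "res \<phi> x \<in> carrier M" using xy by (simp add: res_def j KN \<phi> iN)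
      show "res \<phi> (x \<otimes>\<^bsub>M\<^esub> y) = res \<phi> x \<otimes>\<^bsub>M\<^esub> res \<phi> y"
        using xy hom_mult[OF a(1), of "i x" "i y"] by (simp add: res_def jmult KN \<phi> iN)
    qed
    ultimately show ?thesis by (simp add: auto_def Bij_def res_def)
  qed
  have res_compose: "res (compose (carrier G) \<phi> \<psi>) = compose (carrier M) (res \<phi>) (res \<psi>)"
    if "\<phi> \<in> K" "\<psi> \<in> K" for \<phi> \<psi>
    using that by (auto simp: res_def compose_def fun_eq_iff KN j iN)
  let ?K = "AutoGroup G\<lparr>carrier := K\<rparr>"
  let ?p = "\<lambda>\<phi>. Inn G #>\<^bsub>AutoGroup G\<^esub> \<phi>"
  let ?q = "\<lambda>\<phi>. Inn M #>\<^bsub>AutoGroup M\<^esub> res \<phi>"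
  have res_hom: "res \<in> hom ?K (AutoGroup M)"
  proof (rule homI)
    fix \<phi> \<psi> assume "\<phi> \<in> carrier ?K" "\<psi> \<in> carrier ?K"
    then show "res \<phi> \<in> carrier (AutoGroup M)"
      "res (\<phi> \<otimes>\<^bsub>?K\<^esub> \<psi>) = res \<phi> \<otimes>\<^bsub>AutoGroup M\<^esub> res \<psi>"
      by (simp_all add: res_auto mult_AutoGroup Kauto res_compose)
  qed
  show ?thesis
  proof (rule hom_factor_inj[where K = ?K and p = ?p and q = ?q])
    show "group ?K" by (rule A.subgroup_imp_group[OF K])
    show "group (Out G)" "group (Out M)" by (rule group_Out M.group_Out)+
    have "?p \<in> hom (AutoGroup G) (Out G)"
      unfolding Out_def by (rule normal.r_coset_hom_Mod[OF normal_Inn])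
    then show "?p \<in> hom ?K (Out G)"
      using Kauto by (auto simp: hom_def)
    have "(\<lambda>a. Inn M #>\<^bsub>AutoGroup M\<^esub> a) \<in> hom (AutoGroup M) (Out M)"
      unfolding Out_def by (rule normal.r_coset_hom_Mod[OF M.normal_Inn])
    with res_hom show "?q \<in> hom ?K (Out M)"
      by (simp add: hom_def Pi_iff)
    have Isub: "Inn G \<subseteq> carrier (AutoGroup G)"
      by (rule subgroup.subset[OF normal_imp_subgroup[OF normal_Inn]])
    show "?p ` carrier ?K = carrier (Out G)"
    proof (intro equalityI subsetI)
      fix C assume "C \<in> ?p ` carrier ?K"
      then show "C \<in> carrier (Out G)"
        using Kauto by (auto simp: Out_def FactGroup_def RCOSETS_def)
    next
      fix C assume "C \<in> carrier (Out G)"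
      then obtain \<phi> where \<phi>: "\<phi> \<in> auto G" "C = ?p \<phi>"
        by (auto simp: Out_def FactGroup_def RCOSETS_def)
      from meets[OF \<phi>(1)] obtain g where g: "g \<in> carrier G"
        and in_K: "compose (carrier G) (conj_by g) \<phi> \<in> K" by blast
      have gI: "conj_by g \<in> Inn G" using g by (auto simp: Inn_def)
      have "compose (carrier G) (conj_by g) \<phi> = conj_by g \<otimes>\<^bsub>AutoGroup G\<^esub> \<phi>"
        by (simp only: mult_AutoGroup conj_by_auto g \<phi>)
      moreover have "?p (conj_by g \<otimes>\<^bsub>AutoGroup G\<^esub> \<phi>) = ?p \<phi>"
        using A.coset_mult_assoc[OF Isub, of "conj_by g" \<phi>] \<phi>(1) conj_by_auto[OF g]
          A.coset_join2[OF _ normal_imp_subgroup[OF normal_Inn] gI]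
        by (simp only: carrier_AutoGroup)
      ultimately show "C \<in> ?p ` carrier ?K"
        using in_K \<phi>(2) by (intro image_eqI[of _ _ "compose (carrier G) (conj_by g) \<phi>"]) simp_all
    qed
    fix \<kappa> assume "\<kappa> \<in> carrier ?K"
    then have \<kappa>: "\<kappa> \<in> K" by simp
    note a = autoD[OF Kauto[OF \<kappa>]]
    have "?p \<kappa> = \<one>\<^bsub>Out G\<^esub> \<longleftrightarrow> \<kappa> \<in> Inn G"
      unfolding Out_def by (rule A.Mod_coset_eq_one_iff[OF normal_Inn]) (simp add: Kauto \<kappa>)
    also have "\<dots> \<longleftrightarrow> res \<kappa> \<in> Inn M"
    proof
      assume "\<kappa> \<in> Inn G"
      then obtain g where g: "g \<in> carrier G" and \<kappa>g: "\<kappa> = conj_by g" by (auto simp: Inn_def)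
      have "conj_by g \<in> K" using \<kappa> \<kappa>g by (simp only:)
      then have "g \<in> N" using inner[OF g] by (simp only: N_def)
      then obtain c where c: "c \<in> carrier M" "g = i c" by (auto simp: N_def)
      have "res \<kappa> = M.conj_by c"
      proof (rule extensionalityI[of _ "carrier M"])
        fix x assume x: "x \<in> carrier M"
        have "\<kappa> (i x) = i (c \<otimes>\<^bsub>M\<^esub> x \<otimes>\<^bsub>M\<^esub> inv\<^bsub>M\<^esub> c)"
          using x c by (simp add: \<kappa>g)
        moreover have "j (i (c \<otimes>\<^bsub>M\<^esub> x \<otimes>\<^bsub>M\<^esub> inv\<^bsub>M\<^esub> c)) = c \<otimes>\<^bsub>M\<^esub> x \<otimes>\<^bsub>M\<^esub> inv\<^bsub>M\<^esub> c"
          using x c by (intro ji) simp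
        ultimately show "res \<kappa> x = M.conj_by c x" using x by (simp only: res_def restrict_apply')
      qed (simp_all add: res_def)
      then show "res \<kappa> \<in> Inn M" using c by (auto simp: Inn_def)
    next
      assume "res \<kappa> \<in> Inn M"
      then obtain c where c: "c \<in> carrier M" and res_c: "res \<kappa> = M.conj_by c" by (auto simp: Inn_def)
      define d where "d = i c"
      have d: "d \<in> carrier G" "d \<in> N" using c by (auto simp: d_def N_def)
      have on_N: "\<kappa> y = d \<otimes> y \<otimes> inv d" if y: "y \<in> N" for y
      proof -
        have "\<kappa> y = i (res \<kappa> (j y))" using j y KN \<kappa> by (simp add: res_def)
        then show ?thesis using res_c j[OF y] c by (simp add: d_def)
      qed
      \<comment> \<open>The automorphism \<open>\<phi> = conj_by (inv d) \<circ> \<kappa>\<close> fixes \<open>N\<close> pointwise; comparing \<open>\<phi> (x y inv x)\<close> with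
        \<open>x y inv x\<close> shows that \<open>inv x \<phi> x\<close> centralizes \<open>N\<close>.\<close>
      have "\<kappa> x = conj_by d x" if x: "x \<in> carrier G" for x
      proof -
        have \<kappa>x: "\<kappa> x \<in> carrier G" using a(1) x by (rule hom_in_carrier)
        define e where "e = inv d \<otimes> \<kappa> x \<otimes> d"
        have e: "e \<in> carrier G" using \<kappa>x d by (simp add: e_def)
        have \<kappa>xe: "\<kappa> x = d \<otimes> e \<otimes> inv d"
          using \<kappa>x d by (simp add: e_def m_assoc inv_solve_left[symmetric])
        have "inv x \<otimes> e = \<one>"
        proof (rule centralizer)
          show "inv x \<otimes> e \<in> carrier G" using x e by simp
          fix y assume "y \<in> i ` carrier M"
          then have y: "y \<in> N" and yG: "y \<in> carrier G" using Nsub by (auto simp: N_def)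
          define z where "z = x \<otimes> y \<otimes> inv x"
          have z: "z \<in> N" "z \<in> carrier G" unfolding z_def using N.inv_op_closed2[OF x y] Nsub by auto
          have zx: "z \<otimes> x = x \<otimes> y" using x yG by (simp add: z_def m_assoc)
          have "\<kappa> (z \<otimes> x) = \<kappa> (x \<otimes> y)" by (simp add: zx)
          then have "\<kappa> z \<otimes> \<kappa> x = \<kappa> x \<otimes> \<kappa> y"
            using hom_mult[OF a(1)] x yG z by simp
          then have "d \<otimes> z \<otimes> inv d \<otimes> (d \<otimes> e \<otimes> inv d) = d \<otimes> e \<otimes> inv d \<otimes> (d \<otimes> y \<otimes> inv d)"
            by (simp add: on_N z y \<kappa>xe)
          then have "d \<otimes> (z \<otimes> e) \<otimes> inv d = d \<otimes> (e \<otimes> y) \<otimes> inv d"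
            using d e z yG by (simp add: m_assoc) (simp add: m_assoc[symmetric])
          then have ze: "z \<otimes> e = e \<otimes> y" using d e z yG by simp
          have "inv x \<otimes> e \<otimes> y = inv x \<otimes> (z \<otimes> e)" using x e yG by (simp add: m_assoc ze)
          also have "\<dots> = y \<otimes> (inv x \<otimes> e)"
            using x e yG by (simp add: z_def m_assoc) (simp add: m_assoc[symmetric])
          finally show "inv x \<otimes> e \<otimes> y = y \<otimes> (inv x \<otimes> e)" .
        qed
        then have "e = x" using x e by (metis inv_solve_left' r_one one_closed)
        then show ?thesis using x \<kappa>xe by simp
      qed
      then have "\<kappa> = conj_by d" using a(3) by (intro extensionalityI[of _ "carrier G"]) auto
      then show "\<kappa> \<in> Inn G" using d by (auto simp: Inn_def)
    qed
    also have "\<dots> \<longleftrightarrow> ?q \<kappa> = \<one>\<^bsub>Out M\<^esub>"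
      unfolding Out_def by (rule B.Mod_coset_eq_one_iff[OF M.normal_Inn, symmetric]) (simp add: res_auto \<kappa>)
    finally show "?p \<kappa> = \<one>\<^bsub>Out G\<^esub> \<longleftrightarrow> ?q \<kappa> = \<one>\<^bsub>Out M\<^esub>" .
  qed
qed

section \<open>Free groups\<close>

lemma free_group_carrier_iff: "w \<in> carrier (free_group S) \<longleftrightarrow> reduced w \<and> fst ` set w \<subseteq> S"
  by (simp add: free_group_def)

lemma mult_free_group: "u \<otimes>\<^bsub>free_group S\<^esub> v = foldr cons_reduce u v"
  by (simp add: free_group_def)

lemma one_free_group: "\<one>\<^bsub>free_group S\<^esub> = []"
  by (simp add: free_group_def)

lemma letter_in_free_group: "fst a \<in> S \<Longrightarrow> [a] \<in> carrier (free_group S)"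
  by (simp add: free_group_carrier_iff reduced_def)

lemma inv_letter_free_group:
  "fst a \<in> S \<Longrightarrow> inv\<^bsub>free_group S\<^esub> [a] = [inv_letter a]"
  by (intro group.inv_equality[OF group_free_group] letter_in_free_group)
    (simp_all add: mult_free_group one_free_group)

lemma foldr_cons_reduce_append:
  "reduced (u @ v) \<Longrightarrow> foldr cons_reduce u v = u @ v"
proof (induction u)
  case (Cons a u)
  then show ?case
    using reduced_ConsD[of a "u @ v"] by (simp add: cons_reduce_eq_Cons)
qed simp

lemma reduced_if_constant_sign: "snd ` set w \<subseteq> {b} \<Longrightarrow> reduced w"
  unfolding reduced_def
proof (induction w)
  case (Cons a w)
  then show ?case by (cases w) (auto simp: inv_letter_def)
qed simp

lemma free_group_induct [consumes 1, case_names one letter]: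
  assumes "w \<in> carrier (free_group S)"
    and "P \<one>\<^bsub>free_group S\<^esub>"
    and "\<And>a w. fst a \<in> S \<Longrightarrow> w \<in> carrier (free_group S) \<Longrightarrow> P w \<Longrightarrow> P ([a] \<otimes>\<^bsub>free_group S\<^esub> w)"
  shows "P w"
  using assms(1)
proof (induction w)
  case Nil
  then show ?case using assms(2) by (simp add: one_free_group)
next
  case (Cons a w)
  then have w: "fst a \<in> S" "w \<in> carrier (free_group S)"
    by (auto simp: free_group_carrier_iff dest: reduced_ConsD)
  have "[a] \<otimes>\<^bsub>free_group S\<^esub> w = a # w"
    using Cons.prems by (simp add: mult_free_group free_group_carrier_iff cons_reduce_eq_Cons)
  then show ?case using assms(3)[OF w Cons.IH[OF w(2)]] by simp
qed

lemma free_group_hom_ext: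
  assumes "group H" and h: "h \<in> hom (free_group S) H" and k: "k \<in> hom (free_group S) H"
    and gen: "\<And>x. x \<in> S \<Longrightarrow> h [(x, True)] = k [(x, True)]"
    and w: "w \<in> carrier (free_group S)"
  shows "h w = k w"
proof -
  interpret F: group "free_group S" by (rule group_free_group)
  interpret H: group H by fact
  interpret h: group_hom "free_group S" H h using h by unfold_locales
  interpret k: group_hom "free_group S" H k using k by unfold_locales
  have letter: "h [a] = k [a]" if "fst a \<in> S" for a
  proof (cases "snd a")
    case True
    then show ?thesis using gen[OF that] by (cases a) simp
  next
    case False
    then have "[a] = inv\<^bsub>free_group S\<^esub> [(fst a, True)]"
      using that by (cases a) (simp add: inv_letter_free_group inv_letter_def)
    then show ?thesis using gen that by (simp add: letter_in_free_group)
  qed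
  show ?thesis
    using w
  proof (induction w rule: free_group_induct)
    case one
    show ?case by simp
  next
    case (letter a w)
    then show ?case using \<open>fst a \<in> S \<Longrightarrow> h [a] = k [a]\<close> by (simp add: letter_in_free_group letter)
  qed
qed

lemma (in group) word_value_hom:
  assumes "f \<in> S \<rightarrow> carrier G"
  shows "word_value f \<in> hom (free_group S) G"
  using word_value_closed[OF assms] word_value_foldr[OF assms]
  by (auto simp: hom_def free_group_carrier_iff mult_free_group)

lemma (in group) word_value_letter:
  "f x \<in> carrier G \<Longrightarrow> word_value f [(x, True)] = f x"
  by (simp add: word_value_def)

text \<open>
  If \<open>g\<close> is a nonempty reduced word, choose a generator \<open>z\<close> different from that of the last letter of
  \<open>g\<close>, with the sign of the first letter of \<open>g\<close>. Then nothing cancels in \<open>g z\<^sup>r\<close> or in \<open>z\<^sup>r g\<close>, so the two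
  products are concatenations, and their last letters differ.
\<close>

lemma free_group_commutes_with_powers_trivial:
  assumes g: "g \<in> carrier (free_group S)" and xy: "x \<in> S" "y \<in> S" "x \<noteq> y" and r: "r > 0"
    and comm: "\<And>z b. z \<in> S \<Longrightarrow>
      g \<otimes>\<^bsub>free_group S\<^esub> replicate r (z, b) = replicate r (z, b) \<otimes>\<^bsub>free_group S\<^esub> g"
  shows "g = \<one>\<^bsub>free_group S\<^esub>"
proof (rule ccontr)
  assume "g \<noteq> \<one>\<^bsub>free_group S\<^esub>"
  then have ne: "g \<noteq> []" by (simp add: one_free_group)
  obtain z where z: "z \<in> S" "z \<noteq> fst (last g)" using xy by metis
  define a where "a = (z, snd (hd g))"
  have red: "reduced g" "reduced (replicate r a)"
    using g by (simp add: free_group_carrier_iff, intro reduced_if_constant_sign[of _ "snd a"]) auto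
  have "fst a \<noteq> fst (inv_letter (last g))" "snd (hd g) \<noteq> snd (inv_letter a)"
    using z by (simp_all add: a_def inv_letter_def)
  then have "a \<noteq> inv_letter (last g)" "hd g \<noteq> inv_letter a" by metis+
  then have "reduced (g @ replicate r a)" "reduced (replicate r a @ g)"
    using red ne r by (auto simp: reduced_def successively_append_iff)
  then have "g @ replicate r a = replicate r a @ g"
    using comm[OF z(1), of "snd (hd g)"] foldr_cons_reduce_append[of g "replicate r a"]
      foldr_cons_reduce_append[of "replicate r a" g]
    by (simp only: mult_free_group a_def)
  then have "last (g @ replicate r a) = last (replicate r a @ g)" by simp
  then have "a = last g" using ne r by simp
  then show False using z by (metis a_def fst_conv)
qed

section \<open>Schreier graphs and free bases of stabilizers\<close>

text \<open>
  A graph whose edges are labelled by the generators, with vertex set \<open>Q\<close>: \<open>act\<close> moves a vertex along a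
  letter, and \<open>foldl act q w\<close> is the end of the walk from \<open>q\<close> that spells \<open>w\<close>. The words \<open>t q\<close> lead from
  the base vertex to \<open>q\<close> and are closed under dropping the last letter, so that they trace a spanning
  tree. Tree edges are required to be traversed positively, which suffices when every generator
  permutes \<open>Q\<close> with finite order.
\<close>

locale schreier_graph =
  fixes S :: "'a set" and Q :: "'q set" and act :: "'q \<Rightarrow> 'a letter \<Rightarrow> 'q" and base :: 'q
    and t :: "'q \<Rightarrow> 'a letter list"
  assumes act_closed: "q \<in> Q \<Longrightarrow> fst a \<in> S \<Longrightarrow> act q a \<in> Q"
    and act_inv_letter: "q \<in> Q \<Longrightarrow> fst a \<in> S \<Longrightarrow> act (act q a) (inv_letter a) = q"
    and base: "base \<in> Q"
    and t_base: "t base = []"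
    and t_in: "q \<in> Q \<Longrightarrow> t q \<in> carrier (free_group S)"
    and t_leads: "q \<in> Q \<Longrightarrow> foldl act base (t q) = q"
    and t_parent: "q \<in> Q \<Longrightarrow> q \<noteq> base \<Longrightarrow> \<exists>p\<in>Q. \<exists>x\<in>S. t q = t p @ [(x, True)]"
begin

abbreviation "FS \<equiv> free_group S"

definition tree :: "('q \<times> 'a) set"
  where "tree = {(p, x). p \<in> Q \<and> x \<in> S \<and> t (act p (x, True)) = t p @ [(x, True)]}"

sublocale FS: group FS by (rule group_free_group)

lemma walk_closed: "q \<in> Q \<Longrightarrow> fst ` set w \<subseteq> S \<Longrightarrow> foldl act q w \<in> Q"
  by (induction w arbitrary: q) (auto intro: act_closed)

lemma walk_cons_reduce:
  assumes "q \<in> Q" "fst a \<in> S"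
  shows "foldl act q (cons_reduce a w) = foldl act (act q a) w"
  using assms by (cases w) (auto simp: act_inv_letter)

lemma walk_mult:
  assumes "q \<in> Q" "fst ` set u \<subseteq> S"
  shows "foldl act q (foldr cons_reduce u v) = foldl act (foldl act q u) v"
  using assms by (induction u arbitrary: q) (auto simp: walk_cons_reduce act_closed)

lemma parent_edge:
  assumes "q \<in> Q" "q \<noteq> base"
  shows "\<exists>p x. (p, x) \<in> tree \<and> act p (x, True) = q \<and> t q = t p @ [(x, True)]"
proof -
  from t_parent[OF assms] obtain p x where px: "p \<in> Q" "x \<in> S" "t q = t p @ [(x, True)]" by blast
  then have "act p (x, True) = q"
    using t_leads[OF assms(1)] t_leads[OF px(1)] by simp
  then show ?thesis using px by (auto simp: tree_def)
qed

text \<open>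
  Each vertex other than the base is the end of exactly one tree edge, whose start is its parent.
\<close>

lemma card_tree:
  assumes "finite Q"
  shows "card tree = card Q - 1"
proof -
  have "bij_betw (\<lambda>(p, x). act p (x, True)) tree (Q - {base})"
  proof (rule bij_betw_imageI)
    show "inj_on (\<lambda>(p, x). act p (x, True)) tree"
      using t_leads by (auto simp: inj_on_def tree_def) (metis append1_eq_conv)+
    show "(\<lambda>(p, x). act p (x, True)) ` tree = Q - {base}"
    proof (intro equalityI subsetI)
      fix q assume "q \<in> (\<lambda>(p, x). act p (x, True)) ` tree"
      then show "q \<in> Q - {base}" using t_base by (auto simp: tree_def act_closed)
    next
      fix q assume "q \<in> Q - {base}"
      then show "q \<in> (\<lambda>(p, x). act p (x, True)) ` tree"
        using parent_edge[of q] by (auto simp: image_iff) (metis case_prod_conv)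
    qed
  qed
  then show ?thesis using base assms by (simp add: bij_betw_same_card)
qed

lemma walk_one [simp]: "foldl act q \<one>\<^bsub>FS\<^esub> = q"
  by (simp add: one_free_group)

definition stabilizer :: "'a letter list set"
  where "stabilizer = {w \<in> carrier FS. foldl act base w = base}"

lemma stabilizer_subgroup: "subgroup stabilizer FS"
proof (rule FS.subgroupI)
  have prod: "foldl act base (u \<otimes>\<^bsub>FS\<^esub> v) = foldl act (foldl act base u) v"
    if "u \<in> carrier FS" for u v
    using walk_mult[OF base, of u v] that by (simp add: mult_free_group free_group_carrier_iff)
  show "stabilizer \<subseteq> carrier FS" by (auto simp: stabilizer_def)
  show "stabilizer \<noteq> {}" using FS.one_closed by (auto simp: stabilizer_def intro!: exI[of _ "\<one>\<^bsub>FS\<^esub>"])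
  fix u assume u: "u \<in> stabilizer"
  then have "foldl act base (inv\<^bsub>FS\<^esub> u) = foldl act base (u \<otimes>\<^bsub>FS\<^esub> inv\<^bsub>FS\<^esub> u)"
    using prod[of u] by (simp only: stabilizer_def mem_Collect_eq)
  then show "inv\<^bsub>FS\<^esub> u \<in> stabilizer" using u by (simp add: stabilizer_def)
  fix v assume "v \<in> stabilizer"
  then show "u \<otimes>\<^bsub>FS\<^esub> v \<in> stabilizer" using u by (simp add: stabilizer_def prod)
qed

text \<open>
  The walk \<open>w\<close> from \<open>q\<close>, closed up at both ends through the spanning tree to a loop at the base vertex.
\<close>

definition loop :: "'q \<Rightarrow> 'a letter list \<Rightarrow> 'a letter list"
  where "loop q w = t q \<otimes>\<^bsub>FS\<^esub> w \<otimes>\<^bsub>FS\<^esub> inv\<^bsub>FS\<^esub> t (foldl act q w)"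

end

text \<open>
  The set \<open>E\<close> names the edges outside the spanning tree; they will index a free basis of the stabilizer.
\<close>

locale schreier_edges = schreier_graph S Q act base t
  for S :: "'a set" and Q :: "'q set" and act base t +
  fixes E :: "'e set" and edge :: "'e \<Rightarrow> 'q \<times> 'a"
  assumes edge: "bij_betw edge E (Q \<times> S - tree)"
begin

abbreviation "FE \<equiv> free_group E"

sublocale FE: group FE by (rule group_free_group)

text \<open>
  Contracting the spanning tree turns a walk into a word in the remaining edges: tree edges are erased
  and every other edge contributes its name. A letter with negative sign runs through an edge
  backwards, so its label is that of the edge starting at the vertex \<open>act q a\<close> that it leads to.
\<close>

definition label :: "'q \<Rightarrow> 'a \<Rightarrow> 'e letter list"
  where "label q x = (if (q, x) \<in> tree then \<one>\<^bsub>FE\<^esub> else [(inv_into E edge (q, x), True)])"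

definition letter_label :: "'q \<Rightarrow> 'a letter \<Rightarrow> 'e letter list"
  where "letter_label q a =
    (if snd a then label q (fst a) else inv\<^bsub>FE\<^esub> label (act q a) (fst a))"

primrec rewrite :: "'q \<Rightarrow> 'a letter list \<Rightarrow> 'e letter list"
  where
    "rewrite q [] = \<one>\<^bsub>FE\<^esub>"
  | "rewrite q (a # w) = letter_label q a \<otimes>\<^bsub>FE\<^esub> rewrite (act q a) w"

definition generator :: "'e \<Rightarrow> 'a letter list"
  where "generator e = loop (fst (edge e)) [(snd (edge e), True)]"

lemma label_closed: "q \<in> Q \<Longrightarrow> x \<in> S \<Longrightarrow> label q x \<in> carrier FE"
  using bij_betw_inv_into[OF edge]
  by (auto simp: label_def bij_betw_def intro!: letter_in_free_group)

lemma letter_label_closed: "q \<in> Q \<Longrightarrow> fst a \<in> S \<Longrightarrow> letter_label q a \<in> carrier FE"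
  by (auto simp: letter_label_def intro: label_closed act_closed)

lemma rewrite_closed: "q \<in> Q \<Longrightarrow> fst ` set w \<subseteq> S \<Longrightarrow> rewrite q w \<in> carrier FE"
  by (induction w arbitrary: q) (auto simp: letter_label_closed act_closed)

lemma letter_label_inv_letter:
  assumes "q \<in> Q" "fst a \<in> S"
  shows "letter_label (act q a) (inv_letter a) = inv\<^bsub>FE\<^esub> letter_label q a"
  using assms act_inv_letter[OF assms] label_closed[of "act q a" "fst a"] act_closed[OF assms]
  by (auto simp: letter_label_def) (simp_all add: inv_letter_def)

lemma rewrite_cons_reduce:
  assumes "q \<in> Q" "fst a \<in> S" "fst ` set w \<subseteq> S"
  shows "rewrite q (cons_reduce a w) = rewrite q (a # w)"
proof (cases w)
  case (Cons b v)
  show ?thesis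
  proof (cases "b = inv_letter a")
    case True
    then show ?thesis
      using assms Cons rewrite_closed[of q v] letter_label_closed[OF assms(1,2)]
      by (simp add: letter_label_inv_letter act_inv_letter FE.m_assoc[symmetric])
  qed (simp add: Cons)
qed simp

text \<open>
  Rewriting is a cocycle: the second factor is read from the vertex reached by the first.
\<close>

lemma rewrite_mult:
  assumes "q \<in> Q" "fst ` set u \<subseteq> S" "fst ` set v \<subseteq> S"
  shows "rewrite q (foldr cons_reduce u v) = rewrite q u \<otimes>\<^bsub>FE\<^esub> rewrite (foldl act q u) v"
  using assms
proof (induction u arbitrary: q)
  case (Cons a u)
  have "fst ` set (foldr cons_reduce u v) \<subseteq> S"
    using set_foldr[of u v] Cons.prems by fastforce
  then show ?case
    using Cons act_closed[of q a] walk_closed[of "act q a" u]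
    by (simp add: rewrite_cons_reduce FE.m_assoc letter_label_closed rewrite_closed)
qed (simp add: rewrite_closed)

text \<open>
  The transversal words run inside the tree, so all their labels are erased.
\<close>

lemma rewrite_transversal: "q \<in> Q \<Longrightarrow> rewrite base (t q) = \<one>\<^bsub>FE\<^esub>"
proof (induction "length (t q)" arbitrary: q rule: less_induct)
  case less
  show ?case
  proof (cases "q = base")
    case False
    from parent_edge[OF less.prems False] obtain p x where
      px: "(p, x) \<in> tree" "act p (x, True) = q" "t q = t p @ [(x, True)]" by blast
    then have p: "p \<in> Q" "x \<in> S" by (auto simp: tree_def)
    have "reduced (t p @ [(x, True)])"
      using t_in[OF less.prems] px(3) by (simp add: free_group_carrier_iff)
    then have "t q = foldr cons_reduce (t p) [(x, True)]"
      by (simp only: foldr_cons_reduce_append px(3))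
    moreover have "rewrite base (t p) = \<one>\<^bsub>FE\<^esub>"
      using less.hyps[of p] p px by simp
    ultimately show ?thesis
      using p px(1) t_in[OF p(1)] t_leads[OF p(1)] rewrite_mult[OF base, of "t p" "[(x, True)]"]
      by (simp add: free_group_carrier_iff[of _ S] letter_label_def label_def)
  qed (simp add: t_base)
qed

lemma loop_closed: "q \<in> Q \<Longrightarrow> w \<in> carrier FS \<Longrightarrow> loop q w \<in> carrier FS"
  by (simp add: loop_def t_in walk_closed free_group_carrier_iff[THEN iffD1])

lemma loop_one: "q \<in> Q \<Longrightarrow> loop q \<one>\<^bsub>FS\<^esub> = \<one>\<^bsub>FS\<^esub>"
  by (simp add: loop_def t_in)

text \<open>
  The tree path back to the base after \<open>u\<close> cancels against the tree path out again before \<open>v\<close>.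
\<close>

lemma loop_mult:
  assumes "q \<in> Q" "u \<in> carrier FS" "v \<in> carrier FS"
  shows "loop q (u \<otimes>\<^bsub>FS\<^esub> v) = loop q u \<otimes>\<^bsub>FS\<^esub> loop (foldl act q u) v"
proof -
  have u: "fst ` set u \<subseteq> S" and v: "fst ` set v \<subseteq> S"
    using assms by (auto simp: free_group_carrier_iff)
  have walk: "foldl act q (u \<otimes>\<^bsub>FS\<^esub> v) = foldl act (foldl act q u) v"
    using walk_mult[OF assms(1) u] by (simp add: mult_free_group)
  show ?thesis
    using assms t_in[OF assms(1)] t_in[OF walk_closed[OF assms(1) u]]
      t_in[OF walk_closed[OF walk_closed[OF assms(1) u] v]]
    by (simp add: loop_def walk FS.m_assoc) (simp add: FS.m_assoc[symmetric])
qed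

lemma generator_closed: "generator \<in> E \<rightarrow> carrier FS"
  using bij_betw_apply[OF edge]
  by (auto simp: generator_def mem_Times_iff intro!: loop_closed letter_in_free_group)

definition embed :: "'e letter list \<Rightarrow> 'a letter list"
  where "embed = FS.word_value generator"

sublocale embed: group_hom FE FS embed
  unfolding embed_def using FS.word_value_hom[OF generator_closed] by unfold_locales

lemma embed_generator: "e \<in> E \<Longrightarrow> embed [(e, True)] = generator e"
  unfolding embed_def by (rule FS.word_value_letter[where f = generator, OF funcset_mem[OF generator_closed]])

text \<open>
  For edges outside the tree this is the definition of the generators; for a tree edge the loop is
  trivial, because the transversal word of its end extends that of its start by the edge.
\<close>

lemma embed_label:
  assumes "q \<in> Q" "x \<in> S"
  shows "embed (label q x) = loop q [(x, True)]"
proof (cases "(q, x) \<in> tree")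
  case True
  then have eq: "t (act q (x, True)) = t q @ [(x, True)]" by (simp add: tree_def)
  have "reduced (t q @ [(x, True)])"
    using t_in[OF act_closed[OF assms(1)], of "(x, True)"] assms(2) eq
    by (simp add: free_group_carrier_iff)
  then have "t (act q (x, True)) = t q \<otimes>\<^bsub>FS\<^esub> [(x, True)]"
    by (simp add: mult_free_group foldr_cons_reduce_append eq)
  then show ?thesis
    using True t_in[OF assms(1)] assms(2) letter_in_free_group[of "(x, True)" S]
    by (simp add: label_def loop_def)
next
  case False
  then have "(q, x) \<in> Q \<times> S - tree" using assms by simp
  then have e: "inv_into E edge (q, x) \<in> E" "edge (inv_into E edge (q, x)) = (q, x)"
    using edge by (auto simp: bij_betw_def intro: inv_into_into f_inv_into_f)
  then show ?thesis
    using False generator_closed e(1)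
    by (simp add: label_def embed_generator) (simp add: generator_def)
qed

lemma loop_inv_letter:
  assumes "q \<in> Q" "fst a \<in> S"
  shows "loop (act q a) [inv_letter a] = inv\<^bsub>FS\<^esub> loop q [a]"
proof -
  have "[a] \<in> carrier FS" "[inv_letter a] \<in> carrier FS"
    using assms by (simp_all add: letter_in_free_group)
  then show ?thesis
    using assms act_closed[OF assms] t_in
    by (simp add: loop_def FS.inv_mult_group FS.m_assoc act_inv_letter inv_letter_free_group)
qed

lemma embed_letter_label:
  assumes "q \<in> Q" "fst a \<in> S"
  shows "embed (letter_label q a) = loop q [a]"
proof (cases "snd a")
  case True
  then show ?thesis using embed_label[OF assms] by (cases a) (simp add: letter_label_def)
next
  case False
  have a: "inv_letter a = (fst a, True)" using False by (simp add: inv_letter_def)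
  have q: "act q a \<in> Q" by (rule act_closed[OF assms])
  show ?thesis
    using False assms q loop_closed[OF assms(1) letter_in_free_group[OF assms(2)]]
      loop_inv_letter[OF assms]
    by (simp add: letter_label_def label_closed embed_label a)
qed

text \<open>
  Both sides are cocycles in \<open>w\<close> and agree on letters. For \<open>q = base\<close> and \<open>w\<close> in the stabilizer the
  right-hand side is \<open>w\<close> itself, so \<open>embed\<close> is onto the stabilizer.
\<close>

lemma embed_rewrite:
  assumes "q \<in> Q" "w \<in> carrier FS"
  shows "embed (rewrite q w) = loop q w"
  using assms(2,1)
proof (induction arbitrary: q rule: free_group_induct)
  case one
  have "rewrite q \<one>\<^bsub>FS\<^esub> = \<one>\<^bsub>FE\<^esub>" by (simp add: one_free_group[of S])
  then show ?case by (simp add: loop_one one)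
next
  case (letter a w)
  have w: "fst ` set w \<subseteq> S" using letter by (simp add: free_group_carrier_iff)
  have "rewrite q ([a] \<otimes>\<^bsub>FS\<^esub> w) = letter_label q a \<otimes>\<^bsub>FE\<^esub> rewrite (act q a) w"
    using rewrite_cons_reduce[OF letter.prems letter.hyps(1) w] by (simp add: mult_free_group)
  then show ?case
    using letter w act_closed[OF letter.prems letter.hyps(1)]
    by (simp add: letter_label_closed rewrite_closed embed_letter_label loop_mult letter_in_free_group)
qed

lemma rewrite_stabilizer_hom:
  "rewrite base \<in> hom (FS\<lparr>carrier := stabilizer\<rparr>) FE"
proof (rule homI)
  fix u v assume "u \<in> carrier (FS\<lparr>carrier := stabilizer\<rparr>)" "v \<in> carrier (FS\<lparr>carrier := stabilizer\<rparr>)"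
  then have "fst ` set u \<subseteq> S" "fst ` set v \<subseteq> S" "foldl act base u = base"
    by (auto simp: stabilizer_def free_group_carrier_iff)
  then show "rewrite base u \<in> carrier FE"
    "rewrite base (u \<otimes>\<^bsub>FS\<lparr>carrier := stabilizer\<rparr>\<^esub> v) = rewrite base u \<otimes>\<^bsub>FE\<^esub> rewrite base v"
    by (simp_all add: rewrite_closed base rewrite_mult mult_free_group[where S = S])
qed

lemma loop_in_stabilizer:
  assumes "q \<in> Q" "w \<in> carrier FS"
  shows "loop q w \<in> stabilizer"
proof -
  have w: "fst ` set w \<subseteq> S" using assms by (simp add: free_group_carrier_iff)
  define p where "p = foldl act q w"
  have p: "p \<in> Q" unfolding p_def by (rule walk_closed[OF assms(1) w])
  have c: "t q \<in> carrier FS" "t p \<in> carrier FS" "inv\<^bsub>FS\<^esub> t p \<in> carrier FS"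
    using t_in assms p by auto
  have prod: "foldl act r (u \<otimes>\<^bsub>FS\<^esub> v) = foldl act (foldl act r u) v"
    if "r \<in> Q" "u \<in> carrier FS" for r u v
    using walk_mult[OF that(1), of u v] that(2) by (simp add: mult_free_group free_group_carrier_iff)
  have "foldl act p (inv\<^bsub>FS\<^esub> t p) = foldl act base (t p \<otimes>\<^bsub>FS\<^esub> inv\<^bsub>FS\<^esub> t p)"
    using prod[OF base c(2)] t_leads[OF p] by simp
  also have "\<dots> = base" using c by simp
  finally have "foldl act base (loop q w) = base"
    using prod[OF base] c assms t_leads p
    by (simp add: loop_def prod flip: p_def)
  then show ?thesis using loop_closed[OF assms] by (simp add: stabilizer_def)
qed

lemma rewrite_generator:
  assumes "e \<in> E"
  shows "rewrite base (generator e) = [(e, True)]"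
proof -
  obtain q x where qx: "edge e = (q, x)" by (cases "edge e")
  have q: "q \<in> Q" "x \<in> S" "(q, x) \<notin> tree"
    using bij_betw_apply[OF edge assms] by (auto simp: qx)
  define p where "p = act q (x, True)"
  have p: "p \<in> Q" using q by (simp add: p_def act_closed)
  have set: "fst ` set u \<subseteq> S" if "u \<in> carrier FS" for u
    using that by (simp add: free_group_carrier_iff)
  have c: "t q \<in> carrier FS" "t p \<in> carrier FS" "[(x, True)] \<in> carrier FS"
    using q p by (auto simp: t_in letter_in_free_group)
  have g: "generator e \<in> carrier FS" using generator_closed assms by auto
  \<comment> \<open>Multiplying by the transversal word \<open>t p\<close>, which rewrites to \<open>\<one>\<close>, removes the inverse in the generator.\<close>
  have eq: "generator e \<otimes>\<^bsub>FS\<^esub> t p = t q \<otimes>\<^bsub>FS\<^esub> [(x, True)]"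
    using c by (simp add: generator_def qx loop_def FS.m_assoc flip: p_def)
  have "generator e \<in> stabilizer"
    unfolding generator_def qx using q by (simp add: loop_in_stabilizer c)
  then have "rewrite base (generator e) = rewrite base (generator e \<otimes>\<^bsub>FS\<^esub> t p)"
    using rewrite_mult[OF base set[OF g] set[OF c(2)]] rewrite_transversal[OF p]
      rewrite_closed[OF base set[OF g]]
    by (simp add: mult_free_group[where S = S] stabilizer_def)
  also have "\<dots> = label q x"
    using rewrite_mult[OF base set[OF c(1)] set[OF c(3)]] rewrite_transversal[OF q(1)] label_closed[OF q(1,2)]
    unfolding eq by (simp add: mult_free_group[where S = S] t_leads q letter_label_def)
  also have "\<dots> = [(e, True)]"
    using q edge assms by (simp add: label_def bij_betw_def flip: qx)
  finally show ?thesis .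
qed

lemma embed_in_stabilizer:
  assumes "w \<in> carrier FE"
  shows "embed w \<in> stabilizer"
proof -
  have gen: "generator e \<in> stabilizer" if "e \<in> E" for e
    using bij_betw_apply[OF edge that]
    by (auto simp: generator_def mem_Times_iff intro!: loop_in_stabilizer letter_in_free_group)
  have letter: "embed [a] \<in> stabilizer" if "fst a \<in> E" for a
  proof (cases "snd a")
    case True
    show ?thesis using gen that True by (cases a) (simp add: embed_generator)
  next
    case False
    then have "[a] = inv\<^bsub>FE\<^esub> [(fst a, True)]"
      using that by (cases a) (simp add: inv_letter_free_group inv_letter_def)
    then show ?thesis
      using gen that subgroup.m_inv_closed[OF stabilizer_subgroup]
      by (simp add: letter_in_free_group embed_generator)
  qed
  show ?thesis
    using assms
  proof (induction rule: free_group_induct)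
    case one
    then show ?case using subgroup.one_closed[OF stabilizer_subgroup] by simp
  next
    case (letter a w)
    then show ?case
      using \<open>\<And>a. fst a \<in> E \<Longrightarrow> embed [a] \<in> stabilizer\<close> subgroup.m_closed[OF stabilizer_subgroup]
      by (simp add: letter_in_free_group)
  qed
qed

text \<open>
  The composite is an endomorphism of the free group on \<open>E\<close> which fixes each generator: of the loop
  through the edge \<open>e\<close> only \<open>e\<close> survives the contraction of the tree. Hence \<open>embed\<close> is injective.
\<close>

lemma rewrite_embed:
  assumes "w \<in> carrier FE"
  shows "rewrite base (embed w) = w"
proof (rule free_group_hom_ext[of FE "\<lambda>w. rewrite base (embed w)" E "\<lambda>w. w"])
  show "(\<lambda>w. rewrite base (embed w)) \<in> hom FE FE"
    using rewrite_stabilizer_hom embed_in_stabilizer by (simp add: hom_def Pi_iff)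
  show "rewrite base (embed [(e, True)]) = [(e, True)]" if "e \<in> E" for e
    using that by (simp add: embed_generator rewrite_generator)
qed (use assms in \<open>auto simp: hom_def group_free_group\<close>)

lemma embed_image: "embed ` carrier FE = stabilizer"
proof (intro equalityI subsetI)
  fix w assume "w \<in> stabilizer"
  then have w: "w \<in> carrier FS" "foldl act base w = base" by (auto simp: stabilizer_def)
  have "embed (rewrite base w) = w"
    using w embed_rewrite[OF base w(1)] FS.r_one[OF w(1)] FS.l_one[OF w(1)] FS.inv_one
    by (simp add: loop_def t_base one_free_group[of S])
  then show "w \<in> embed ` carrier FE"
    using w rewrite_closed[OF base, of w] by (intro image_eqI[of _ _ "rewrite base w"]) (auto simp: free_group_carrier_iff)
qed (auto intro: embed_in_stabilizer)

end

text \<open>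
  Schreier's index formula. The graph has \<open>card Q * card S\<close> edges, of which \<open>card Q - 1\<close> lie in the
  spanning tree.
\<close>

theorem (in schreier_graph) stabilizer_free:
  assumes "finite Q" "finite S" "S \<noteq> {}"
  shows "\<exists>i. i \<in> hom (free_group {..<card Q * (card S - 1) + 1}) FS
    \<and> inj_on i (carrier (free_group {..<card Q * (card S - 1) + 1}))
    \<and> i ` carrier (free_group {..<card Q * (card S - 1) + 1}) = stabilizer"
proof -
  let ?m = "card Q * (card S - 1) + 1"
  have sub: "tree \<subseteq> Q \<times> S" by (auto simp: tree_def)
  have Q: "card Q > 0" using base assms(1) by (auto simp: card_gt_0_iff)
  have "card (Q \<times> S - tree) = card Q * card S - (card Q - 1)"
    using sub assms finite_subset[OF sub] by (simp add: card_Diff_subset card_tree card_cartesian_product)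
  also have "\<dots> = ?m"
  proof -
    obtain k where "card S = Suc k" using assms by (metis card_0_eq not0_implies_Suc)
    then show ?thesis using Q by simp
  qed
  finally have "card (Q \<times> S - tree) = card {..<?m}" by simp
  then obtain edge where "bij_betw edge {..<?m} (Q \<times> S - tree)"
    using assms by (metis bij_betw_iff_card finite_Diff finite_cartesian_product finite_lessThan)
  then interpret schreier_edges S Q act base t "{..<?m}" edge by unfold_locales
  have "inj_on embed (carrier FE)" by (rule inj_on_inverseI[of _ "rewrite base"]) (rule rewrite_embed)
  then show ?thesis using embed.homh embed_image by blast
qed

section \<open>The Magnus expansion to second order\<close>

text \<open>
  The Magnus expansion sends the generator \<open>x\<^sub>i\<close> to \<open>1 + X\<^sub>i\<close> in the ring of noncommutative power series.
  Truncated after degree two, the units with constant term 1 form a group, whose elements are recorded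
  by their coefficients at \<open>X\<^sub>k\<close> and at \<open>X\<^sub>k X\<^sub>l\<close>.
\<close>

type_synonym jet = "(nat \<Rightarrow> int) \<times> (nat \<Rightarrow> nat \<Rightarrow> int)"

definition magnus_group :: "jet monoid"
  where "magnus_group = \<lparr>carrier = UNIV,
    mult = (\<lambda>(a, b) (a', b'). (\<lambda>k. a k + a' k, \<lambda>k l. b k l + b' k l + a k * a' l)),
    one = (\<lambda>_. 0, \<lambda>_ _. 0)\<rparr>"

lemma group_magnus: "group magnus_group"
proof (rule groupI)
  fix x :: jet
  obtain a b where x: "x = (a, b)" by (cases x)
  show "\<exists>y\<in>carrier magnus_group. y \<otimes>\<^bsub>magnus_group\<^esub> x = \<one>\<^bsub>magnus_group\<^esub>"
    by (intro bexI[of _ "(\<lambda>k. - a k, \<lambda>k l. a k * a l - b k l)"])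
      (simp_all add: magnus_group_def x)
qed (auto simp: magnus_group_def algebra_simps split: prod.splits)

definition magnus :: "nat letter list \<Rightarrow> jet"
  where "magnus = group.word_value magnus_group (\<lambda>i. (\<lambda>k. if k = i then 1 else 0, \<lambda>_ _. 0))"

definition exponent_sum :: "nat letter list \<Rightarrow> nat \<Rightarrow> int"
  where "exponent_sum w = fst (magnus w)"

definition second_order :: "nat letter list \<Rightarrow> nat \<Rightarrow> nat \<Rightarrow> int"
  where "second_order w = snd (magnus w)"

definition int_group :: "int monoid"
  where "int_group = \<lparr>carrier = UNIV, mult = (+), one = 0\<rparr>"

lemma group_int_group: "group int_group"
  by (rule groupI) (auto simp: int_group_def intro: exI[of _ "- x" for x])

lemma sum_swap_pairs:
  "(\<Sum>s\<in>A. \<Sum>t\<in>B. \<Sum>p\<in>C. \<Sum>q\<in>D. f s t p q) = (\<Sum>p\<in>C. \<Sum>q\<in>D. \<Sum>s\<in>A. \<Sum>t\<in>B. f s t p q)"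
proof -
  have "(\<Sum>s\<in>A. \<Sum>t\<in>B. \<Sum>p\<in>C. \<Sum>q\<in>D. f s t p q) = (\<Sum>s\<in>A. \<Sum>p\<in>C. \<Sum>t\<in>B. \<Sum>q\<in>D. f s t p q)"
    by (rule sum.cong[OF refl], rule sum.swap)
  also have "\<dots> = (\<Sum>p\<in>C. \<Sum>s\<in>A. \<Sum>t\<in>B. \<Sum>q\<in>D. f s t p q)"
    by (rule sum.swap)
  also have "\<dots> = (\<Sum>p\<in>C. \<Sum>s\<in>A. \<Sum>q\<in>D. \<Sum>t\<in>B. f s t p q)"
    by (rule sum.cong[OF refl], rule sum.cong[OF refl], rule sum.swap)
  also have "\<dots> = (\<Sum>p\<in>C. \<Sum>q\<in>D. \<Sum>s\<in>A. \<Sum>t\<in>B. f s t p q)"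
    by (rule sum.cong[OF refl], rule sum.swap)
  finally show ?thesis .
qed

locale free_rank =
  fixes n :: nat
begin

abbreviation "F \<equiv> free_group {..<n}"

abbreviation gen :: "nat \<Rightarrow> nat letter list"
  where "gen i \<equiv> [(i, True)]"

sublocale F: group F by (rule group_free_group)

sublocale AutF: group "AutoGroup F" by (rule F.AutoGroup)

lemma gen_closed: "i < n \<Longrightarrow> gen i \<in> carrier F"
  by (simp add: letter_in_free_group)

sublocale magnus: group_hom F magnus_group magnus
proof -
  interpret magnus_group: group magnus_group by (rule group_magnus)
  have "magnus \<in> hom F magnus_group"
    unfolding magnus_def by (rule magnus_group.word_value_hom) (simp add: magnus_group_def)
  then show "group_hom F magnus_group magnus" by unfold_locales
qed

lemma exponent_sum_mult:
  assumes "u \<in> carrier F" "v \<in> carrier F"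
  shows "exponent_sum (u \<otimes>\<^bsub>F\<^esub> v) k = exponent_sum u k + exponent_sum v k"
  using assms by (simp add: exponent_sum_def magnus_group_def split: prod.splits)

lemma second_order_mult:
  assumes "u \<in> carrier F" "v \<in> carrier F"
  shows "second_order (u \<otimes>\<^bsub>F\<^esub> v) k l = second_order u k l + second_order v k l + exponent_sum u k * exponent_sum v l"
  using assms by (simp add: exponent_sum_def second_order_def magnus_group_def split: prod.splits)

lemma exponent_sum_one: "exponent_sum \<one>\<^bsub>F\<^esub> k = 0" and second_order_one: "second_order \<one>\<^bsub>F\<^esub> k l = 0"
  by (simp_all add: exponent_sum_def second_order_def magnus_group_def)

lemma exponent_sum_inv: "w \<in> carrier F \<Longrightarrow> exponent_sum (inv\<^bsub>F\<^esub> w) k = - exponent_sum w k"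
  using exponent_sum_mult[of w "inv\<^bsub>F\<^esub> w" k] by (simp add: exponent_sum_one)

lemma second_order_inv:
  "w \<in> carrier F \<Longrightarrow> second_order (inv\<^bsub>F\<^esub> w) k l = exponent_sum w k * exponent_sum w l - second_order w k l"
  using second_order_mult[of w "inv\<^bsub>F\<^esub> w" k l] by (simp add: second_order_one exponent_sum_inv)

lemma exponent_sum_gen: "exponent_sum (gen i) k = (if k = i then 1 else 0)"
proof -
  have "magnus (gen i) = (\<lambda>k. if k = i then 1 else 0, \<lambda>_ _. 0)"
    unfolding magnus_def by (rule group.word_value_letter[OF group_magnus]) (simp add: magnus_group_def)
  then show ?thesis by (simp add: exponent_sum_def)
qed

text \<open>
  A homomorphism from \<open>F\<close> to the integers factors through the abelianization.
\<close>

lemma additive_eq_linear_combination: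
  fixes f :: "nat letter list \<Rightarrow> int"
  assumes add: "\<And>u v. u \<in> carrier F \<Longrightarrow> v \<in> carrier F \<Longrightarrow> f (u \<otimes>\<^bsub>F\<^esub> v) = f u + f v"
    and w: "w \<in> carrier F"
  shows "f w = (\<Sum>i<n. f (gen i) * exponent_sum w i)"
proof (rule free_group_hom_ext[OF group_int_group _ _ _ w])
  show "f \<in> hom F int_group" "(\<lambda>w. \<Sum>i<n. f (gen i) * exponent_sum w i) \<in> hom F int_group"
    by (simp_all add: hom_def int_group_def add exponent_sum_mult sum.distrib distrib_left)
  show "f (gen x) = (\<Sum>i<n. f (gen i) * exponent_sum (gen x) i)" if "x \<in> {..<n}" for x
    using that by (simp add: exponent_sum_gen if_distrib[of "(*) _"] cong: if_cong)
qed

end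

lemma exponent_sum_Nil [simp]: "exponent_sum [] k = 0"
  using free_rank.exponent_sum_one[of 0 k] by (simp add: one_free_group)

lemma exponent_sum_letter:
  "exponent_sum [(i, b)] k = (if k = i then if b then 1 else - 1 else 0)"
proof -
  interpret free_rank "Suc i" .
  have "exponent_sum (inv\<^bsub>F\<^esub> gen i) k = - exponent_sum (gen i) k"
    by (rule exponent_sum_inv) (simp add: gen_closed)
  then show ?thesis
    by (cases b) (simp_all add: exponent_sum_gen inv_letter_free_group inv_letter_def)
qed

lemma exponent_sum_Cons: "exponent_sum (a # w) k = exponent_sum [a] k + exponent_sum w k"
proof -
  interpret magnus_group: group magnus_group by (rule group_magnus)
  have "magnus (a # w) = magnus [a] \<otimes>\<^bsub>magnus_group\<^esub> magnus w"
    by (simp add: magnus_def magnus_group.word_value_def) (simp add: magnus_group_def split: prod.splits)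
  then show ?thesis by (simp add: exponent_sum_def magnus_group_def split: prod.splits)
qed

lemma exponent_sum_append: "exponent_sum (u @ v) k = exponent_sum u k + exponent_sum v k"
proof (induction u)
  case (Cons a u)
  then show ?case using exponent_sum_Cons[of a "u @ v" k] exponent_sum_Cons[of a u k] by simp
qed simp

lemma exponent_sum_replicate: "exponent_sum (replicate m (i, b)) k = (if k = i then if b then int m else - int m else 0)"
proof (induction m)
  case (Suc m)
  then show ?case using exponent_sum_Cons[of "(i, b)" "replicate m (i, b)" k] by (simp add: exponent_sum_letter)
qed simp

text \<open>
  The word \<open>x\<^sub>0\<^bsup>q(0)\<^esup> x\<^sub>1\<^bsup>q(1)\<^esup> \<dots>\<close>, which realizes a prescribed nonnegative vector of exponent sums. These
  words are also the transversal used for the spanning tree of the abelian cover.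
\<close>

definition monomial :: "nat \<Rightarrow> (nat \<Rightarrow> nat) \<Rightarrow> nat letter list"
  where "monomial n q = concat (map (\<lambda>i. replicate (q i) (i, True)) [0..<n])"

lemma exponent_sum_monomial: "exponent_sum (monomial n q) k = (if k < n then int (q k) else 0)"
  by (induction n) (auto simp: monomial_def exponent_sum_append exponent_sum_replicate less_Suc_eq)

lemma monomial_closed: "monomial n q \<in> carrier (free_group {..<n})"
  by (auto simp: monomial_def free_group_carrier_iff intro!: reduced_if_constant_sign[of _ True])

section \<open>The trace cocycle\<close>

context free_rank
begin

text \<open>
  The matrix of the action of \<open>\<phi>\<close> on the abelianization \<open>H\<close>.
\<close>

definition jac :: "(nat letter list \<Rightarrow> nat letter list) \<Rightarrow> nat \<Rightarrow> nat \<Rightarrow> int"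
  where "jac \<phi> k p = exponent_sum (\<phi> (gen p)) k"

lemma exponent_sum_hom:
  assumes "\<phi> \<in> hom F F" "w \<in> carrier F"
  shows "exponent_sum (\<phi> w) k = (\<Sum>p<n. jac \<phi> k p * exponent_sum w p)"
  unfolding jac_def
  by (rule additive_eq_linear_combination[where f = "\<lambda>w. exponent_sum (\<phi> w) k"])
    (use assms in \<open>simp_all add: hom_mult exponent_sum_mult hom_in_carrier\<close>)

text \<open>
  The second-order coefficients of a word form an element of \<open>H \<otimes> H\<close>. The defect compares those of
  \<open>\<phi> w\<close> with the image of those of \<open>w\<close> under the action of \<open>\<phi>\<close> on \<open>H \<otimes> H\<close>.
\<close>

definition defect :: "(nat letter list \<Rightarrow> nat letter list) \<Rightarrow> nat letter list \<Rightarrow> nat \<Rightarrow> nat \<Rightarrow> int"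
  where "defect \<phi> w k l = second_order (\<phi> w) k l - (\<Sum>p<n. \<Sum>q<n. jac \<phi> k p * jac \<phi> l q * second_order w p q)"

text \<open>
  The quadratic term in the product formula for \<open>second_order\<close> is natural in \<open>H\<close>, so it cancels; the
  defect therefore depends only on the class of the word in \<open>H\<close>.
\<close>

lemma defect_mult:
  assumes \<phi>: "\<phi> \<in> hom F F" and uv: "u \<in> carrier F" "v \<in> carrier F"
  shows "defect \<phi> (u \<otimes>\<^bsub>F\<^esub> v) k l = defect \<phi> u k l + defect \<phi> v k l"
proof -
  have "exponent_sum (\<phi> u) k * exponent_sum (\<phi> v) l
      = (\<Sum>p<n. \<Sum>q<n. jac \<phi> k p * jac \<phi> l q * (exponent_sum u p * exponent_sum v q))"
    by (simp add: exponent_sum_hom[OF \<phi>] uv sum_product algebra_simps)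
  then show ?thesis
    using uv hom_in_carrier[OF \<phi>]
    by (simp add: defect_def hom_mult[OF \<phi>] second_order_mult sum.distrib distrib_left)
qed

lemma jac_compose:
  assumes "\<phi> \<in> hom F F" "\<psi> \<in> hom F F" "p < n"
  shows "jac (compose (carrier F) \<phi> \<psi>) k p = (\<Sum>s<n. jac \<phi> k s * jac \<psi> s p)"
  using assms exponent_sum_hom[OF assms(1), of "\<psi> (gen p)"]
  by (simp add: jac_def compose_def gen_closed hom_in_carrier)

lemma defect_compose:
  assumes \<phi>: "\<phi> \<in> hom F F" and \<psi>: "\<psi> \<in> hom F F" and w: "w \<in> carrier F"
  shows "defect (compose (carrier F) \<phi> \<psi>) w k l
    = defect \<phi> (\<psi> w) k l + (\<Sum>p<n. \<Sum>q<n. jac \<phi> k p * jac \<phi> l q * defect \<psi> w p q)"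
proof -
  let ?J = "\<lambda>p q. jac \<phi> k p * jac \<phi> l q"
  have "(\<Sum>s<n. \<Sum>t<n. jac (compose (carrier F) \<phi> \<psi>) k s * jac (compose (carrier F) \<phi> \<psi>) l t * second_order w s t)
      = (\<Sum>s<n. \<Sum>t<n. \<Sum>p<n. \<Sum>q<n. ?J p q * (jac \<psi> p s * jac \<psi> q t * second_order w s t))"
    by (intro sum.cong refl, simp add: jac_compose \<phi> \<psi> sum_product)
      (simp add: sum_distrib_left mult_ac)
  also have "\<dots> = (\<Sum>p<n. \<Sum>q<n. \<Sum>s<n. \<Sum>t<n. ?J p q * (jac \<psi> p s * jac \<psi> q t * second_order w s t))"
    by (rule sum_swap_pairs)
  finally have "(\<Sum>s<n. \<Sum>t<n. jac (compose (carrier F) \<phi> \<psi>) k s * jac (compose (carrier F) \<phi> \<psi>) l t * second_order w s t)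
      = (\<Sum>p<n. \<Sum>q<n. ?J p q * (\<Sum>s<n. \<Sum>t<n. jac \<psi> p s * jac \<psi> q t * second_order w s t))"
    by (simp add: sum_distrib_left)
  then show ?thesis
    using w by (simp add: defect_def compose_def sum_subtractf right_diff_distrib)
qed

definition inv_auto :: "(nat letter list \<Rightarrow> nat letter list) \<Rightarrow> nat letter list \<Rightarrow> nat letter list"
  where "inv_auto \<phi> = inv\<^bsub>AutoGroup F\<^esub> \<phi>"

text \<open>
  Since the defect is additive, \<open>w \<mapsto> defect \<phi> (\<phi>\<inverse> w)\<close> is a linear map \<open>H \<rightarrow> H \<otimes> H\<close>. Contracting its argument
  with the second tensor factor leaves a vector in \<open>H\<close>. The inverse of \<open>\<phi>\<close> is inserted so that the
  linear maps form a cocycle for the conjugation action of \<open>Aut F\<close> on \<open>Hom(H, H \<otimes> H)\<close>, for which the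
  contraction is equivariant.
\<close>

definition trace_cocycle :: "(nat letter list \<Rightarrow> nat letter list) \<Rightarrow> nat \<Rightarrow> int"
  where "trace_cocycle \<phi> k = (\<Sum>j<n. defect \<phi> (inv_auto \<phi> (gen j)) k j)"

lemma inv_auto_closed: "\<phi> \<in> auto F \<Longrightarrow> inv_auto \<phi> \<in> auto F"
  unfolding inv_auto_def using AutF.inv_closed[of \<phi>] by simp

lemma auto_hom: "\<phi> \<in> auto F \<Longrightarrow> \<phi> \<in> hom F F"
  by (simp add: auto_def)

lemma compose_inv_auto:
  assumes "\<phi> \<in> auto F"
  shows "compose (carrier F) \<phi> (inv_auto \<phi>) = (\<lambda>x\<in>carrier F. x)"
    and "compose (carrier F) (inv_auto \<phi>) \<phi> = (\<lambda>x\<in>carrier F. x)"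
proof -
  have "compose (carrier F) \<phi> (inv_auto \<phi>) = \<phi> \<otimes>\<^bsub>AutoGroup F\<^esub> inv_auto \<phi>"
    "compose (carrier F) (inv_auto \<phi>) \<phi> = inv_auto \<phi> \<otimes>\<^bsub>AutoGroup F\<^esub> \<phi>"
    using assms by (simp_all add: mult_AutoGroup inv_auto_closed)
  then show "compose (carrier F) \<phi> (inv_auto \<phi>) = (\<lambda>x\<in>carrier F. x)"
    "compose (carrier F) (inv_auto \<phi>) \<phi> = (\<lambda>x\<in>carrier F. x)"
    using assms by (simp_all add: inv_auto_def one_AutoGroup)
qed

lemma inv_auto_apply:
  assumes "\<phi> \<in> auto F" "w \<in> carrier F"
  shows "\<phi> (inv_auto \<phi> w) = w" "inv_auto \<phi> (\<phi> w) = w"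
  using fun_cong[OF compose_inv_auto(1)[OF assms(1)], of w]
    fun_cong[OF compose_inv_auto(2)[OF assms(1)], of w] assms(2)
  by (simp_all add: compose_def)

lemma inv_auto_compose:
  assumes "\<phi> \<in> auto F" "\<psi> \<in> auto F"
  shows "inv_auto (compose (carrier F) \<phi> \<psi>) = compose (carrier F) (inv_auto \<psi>) (inv_auto \<phi>)"
proof -
  have "inv_auto (\<phi> \<otimes>\<^bsub>AutoGroup F\<^esub> \<psi>) = inv_auto \<psi> \<otimes>\<^bsub>AutoGroup F\<^esub> inv_auto \<phi>"
    unfolding inv_auto_def using assms by (simp add: AutF.inv_mult_group)
  then show ?thesis using assms by (simp add: mult_AutoGroup inv_auto_closed)
qed

lemma jac_inv_auto:
  assumes "\<phi> \<in> auto F" "l < n" "i < n"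
  shows "(\<Sum>j<n. jac (inv_auto \<phi>) l j * jac \<phi> j i) = (if l = i then 1 else 0)"
proof -
  have id: "jac (\<lambda>x\<in>carrier F. x) l i = (if l = i then 1 else 0)"
    using assms by (simp add: jac_def gen_closed exponent_sum_gen)
  show ?thesis
    using assms id by (simp add: jac_compose[symmetric] auto_hom inv_auto_closed compose_inv_auto)
qed

text \<open>
  The crossed homomorphism property. By \<open>defect_compose\<close> the contribution of \<open>\<psi>\<close> is transformed by the
  matrix of \<open>\<phi>\<close> in both tensor factors and by its inverse in the argument; in the contraction the inverse
  cancels one of the two.
\<close>

lemma trace_cocycle_compose:
  assumes \<phi>: "\<phi> \<in> auto F" and \<psi>: "\<psi> \<in> auto F"
  shows "trace_cocycle (compose (carrier F) \<phi> \<psi>) k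
    = trace_cocycle \<phi> k + (\<Sum>p<n. jac \<phi> k p * trace_cocycle \<psi> p)"
proof -
  let ?D = "\<lambda>s p q. defect \<psi> (inv_auto \<psi> (gen s)) p q"
  have \<phi>h: "\<phi> \<in> hom F F" and \<psi>h: "\<psi> \<in> hom F F" and \<phi>i: "inv_auto \<phi> \<in> hom F F" and \<psi>i: "inv_auto \<psi> \<in> hom F F"
    using \<phi> \<psi> by (simp_all add: auto_hom inv_auto_closed)
  have in_F: "inv_auto \<phi> (gen j) \<in> carrier F" if "j < n" for j
    using hom_in_carrier[OF \<phi>i] gen_closed that by blast
  have D: "defect \<psi> (inv_auto \<psi> w) p q = (\<Sum>s<n. ?D s p q * exponent_sum w s)" if "w \<in> carrier F" for w p q
    by (rule additive_eq_linear_combination[where f = "\<lambda>w. defect \<psi> (inv_auto \<psi> w) p q", OF _ that])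
      (simp add: hom_mult[OF \<psi>i] defect_mult[OF \<psi>h] hom_in_carrier[OF \<psi>i])
  have "trace_cocycle (compose (carrier F) \<phi> \<psi>) k
      = (\<Sum>j<n. defect (compose (carrier F) \<phi> \<psi>) (inv_auto \<psi> (inv_auto \<phi> (gen j))) k j)"
    unfolding trace_cocycle_def inv_auto_compose[OF \<phi> \<psi>]
    by (intro sum.cong refl) (simp add: compose_eq[where g = "inv_auto \<psi>"] gen_closed)
  also have "\<dots> = (\<Sum>j<n. defect \<phi> (inv_auto \<phi> (gen j)) k j
      + (\<Sum>p<n. \<Sum>q<n. jac \<phi> k p * jac \<phi> j q * (\<Sum>s<n. ?D s p q * jac (inv_auto \<phi>) s j)))"
    by (intro sum.cong refl)
      (simp add: defect_compose[OF \<phi>h \<psi>h] hom_in_carrier[OF \<psi>i] in_F inv_auto_apply[OF \<psi>] D jac_def[of "inv_auto \<phi>"])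
  also have "\<dots> = trace_cocycle \<phi> k
      + (\<Sum>j<n. \<Sum>p<n. \<Sum>q<n. \<Sum>s<n. jac \<phi> k p * ?D s p q * (jac (inv_auto \<phi>) s j * jac \<phi> j q))"
    by (simp add: trace_cocycle_def sum.distrib sum_distrib_left algebra_simps)
  also have "(\<Sum>j<n. \<Sum>p<n. \<Sum>q<n. \<Sum>s<n. jac \<phi> k p * ?D s p q * (jac (inv_auto \<phi>) s j * jac \<phi> j q))
      = (\<Sum>p<n. \<Sum>q<n. \<Sum>s<n. \<Sum>j<n. jac \<phi> k p * ?D s p q * (jac (inv_auto \<phi>) s j * jac \<phi> j q))"
    by (rule trans[OF sum.swap], rule sum.cong[OF refl], rule trans[OF sum.swap],
        rule sum.cong[OF refl], rule sum.swap)
  also have "\<dots> = (\<Sum>p<n. \<Sum>q<n. \<Sum>s<n. jac \<phi> k p * ?D s p q * (if s = q then 1 else 0))"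
    by (intro sum.cong refl) (simp add: jac_inv_auto[OF \<phi>] flip: sum_distrib_left)
  also have "\<dots> = (\<Sum>p<n. \<Sum>q<n. jac \<phi> k p * ?D q p q)"
    by (intro sum.cong refl) (simp add: if_distrib[of "(*) _"] cong: if_cong)
  also have "\<dots> = (\<Sum>p<n. jac \<phi> k p * trace_cocycle \<psi> p)"
    by (simp add: trace_cocycle_def sum_distrib_left)
  finally show ?thesis .
qed

lemma exponent_sum_conj:
  "g \<in> carrier F \<Longrightarrow> w \<in> carrier F \<Longrightarrow> exponent_sum (g \<otimes>\<^bsub>F\<^esub> w \<otimes>\<^bsub>F\<^esub> inv\<^bsub>F\<^esub> g) k = exponent_sum w k"
  by (simp add: exponent_sum_mult exponent_sum_inv)

lemma jac_conj:
  "g \<in> carrier F \<Longrightarrow> p < n \<Longrightarrow> jac (F.conj_by g) k p = (if k = p then 1 else 0)"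
  by (simp add: jac_def exponent_sum_conj exponent_sum_gen gen_closed)

text \<open>
  For conjugation by \<open>g\<close> the linear map \<open>H \<rightarrow> H \<otimes> H\<close> is \<open>v \<mapsto> [g] \<otimes> v - v \<otimes> [g]\<close>. Contraction takes the
  first term to \<open>n [g]\<close>, the trace of the identity, and the second to \<open>[g]\<close>.
\<close>

lemma trace_cocycle_conj:
  assumes g: "g \<in> carrier F" and k: "k < n"
  shows "trace_cocycle (F.conj_by g) k = (int n - 1) * exponent_sum g k"
proof -
  note jac = jac_conj[OF g]
  have \<phi>: "F.conj_by g \<in> auto F" by (rule F.conj_by_auto[OF g])
  have "defect (F.conj_by g) w k j = exponent_sum g k * exponent_sum w j - exponent_sum w k * exponent_sum g j"
    if "w \<in> carrier F" "j < n" for w j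
  proof -
    have "(\<Sum>p<n. \<Sum>q<n. jac (F.conj_by g) k p * jac (F.conj_by g) j q * second_order w p q)
        = (\<Sum>p<n. if k = p then \<Sum>q<n. if j = q then second_order w p q else 0 else 0)"
      by (intro sum.cong refl) (auto simp: jac simp del: sum.delta sum.delta' intro!: sum.cong)
    also have "\<dots> = second_order w k j"
      using k that(2) by simp
    finally show ?thesis
      using that(1) g by (simp add: defect_def second_order_mult exponent_sum_mult exponent_sum_inv second_order_inv algebra_simps)
  qed
  moreover have "exponent_sum (inv_auto (F.conj_by g) (gen j)) l = exponent_sum (gen j) l" if "j < n" for j l
  proof -
    have c: "inv_auto (F.conj_by g) (gen j) \<in> carrier F"
      using hom_in_carrier[OF auto_hom[OF inv_auto_closed[OF \<phi>]]] gen_closed[OF that] .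
    have "gen j = g \<otimes>\<^bsub>F\<^esub> inv_auto (F.conj_by g) (gen j) \<otimes>\<^bsub>F\<^esub> inv\<^bsub>F\<^esub> g"
      using inv_auto_apply(1)[OF \<phi> gen_closed[OF that]] c by simp
    then show ?thesis using exponent_sum_conj[OF g c] by metis
  qed
  ultimately have "trace_cocycle (F.conj_by g) k
      = (\<Sum>j<n. exponent_sum g k * exponent_sum (gen j) j - exponent_sum (gen j) k * exponent_sum g j)"
    unfolding trace_cocycle_def
    using hom_in_carrier[OF auto_hom[OF inv_auto_closed[OF \<phi>]]] gen_closed
    by (intro sum.cong refl) simp
  also have "\<dots> = (\<Sum>j<n. exponent_sum g k - (if k = j then exponent_sum g k else 0))"
    by (intro sum.cong refl) (auto simp: exponent_sum_gen)
  also have "\<dots> = (int n - 1) * exponent_sum g k"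
    using k by (simp add: sum_subtractf algebra_simps)
  finally show ?thesis .
qed

lemma trace_cocycle_id: "trace_cocycle (\<lambda>x\<in>carrier F. x) k = 0" if "k < n"
  using trace_cocycle_conj[OF F.one_closed that] by (simp only: F.conj_by_one exponent_sum_one mult_zero_right)

end

section \<open>The abelian cover of exponent r\<close>

locale abelian_cover = free_rank +
  fixes r :: nat
  assumes r: "r > 1" and n: "n \<ge> 2"
begin

text \<open>
  The vertices of the cover are the elements of \<open>(\<int>/r)\<^sup>n\<close>, represented by vectors of residues.
\<close>

definition torus :: "(nat \<Rightarrow> nat) set"
  where "torus = {..<n} \<rightarrow>\<^sub>E {..<r}"

definition origin :: "nat \<Rightarrow> nat"
  where "origin = (\<lambda>i\<in>{..<n}. 0)"

text \<open>
  The exponent sum of a single letter at its own generator is its sign, so a letter moves one step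
  forwards or backwards along its coordinate circle.
\<close>

definition translate :: "(nat \<Rightarrow> nat) \<Rightarrow> nat letter \<Rightarrow> nat \<Rightarrow> nat"
  where "translate q a = q(fst a := nat ((int (q (fst a)) + exponent_sum [a] (fst a)) mod int r))"

definition N :: "nat letter list set"
  where "N = {w \<in> carrier F. \<forall>k<n. int r dvd exponent_sum w k}"

lemma origin_in_torus: "origin \<in> torus"
  using r by (auto simp: origin_def torus_def)

lemma translate_closed: "q \<in> torus \<Longrightarrow> fst a \<in> {..<n} \<Longrightarrow> translate q a \<in> torus"
  using r by (auto simp: translate_def torus_def PiE_iff extensional_def nat_less_iff)

lemma torus_eqI:
  "p \<in> torus \<Longrightarrow> q \<in> torus \<Longrightarrow> (\<And>k. k < n \<Longrightarrow> int (p k) mod int r = int (q k) mod int r) \<Longrightarrow> p = q"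
  unfolding torus_def by (rule PiE_ext) (auto simp: PiE_iff)

lemma translate_mod:
  "int (translate q a k) mod int r = (int (q k) + exponent_sum [a] k) mod int r"
  using r by (cases a) (auto simp: translate_def exponent_sum_letter)

text \<open>
  Walking translates by the class of the word, hence closed walks are spelled exactly by the words in \<open>N\<close>.
\<close>

lemma walk_torus:
  assumes "q \<in> torus" "fst ` set w \<subseteq> {..<n}"
  shows "foldl translate q w \<in> torus
    \<and> (\<forall>k. int (foldl translate q w k) mod int r = (int (q k) + exponent_sum w k) mod int r)"
  using assms
proof (induction w arbitrary: q)
  case (Cons a w)
  then have "foldl translate (translate q a) w \<in> torus
    \<and> (\<forall>k. int (foldl translate (translate q a) w k) mod int r = (int (translate q a k) + exponent_sum w k) mod int r)"
    by (simp add: translate_closed)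
  moreover have "(int (translate q a k) + exponent_sum w k) mod int r = (int (q k) + exponent_sum (a # w) k) mod int r" for k
    using translate_mod[of q a k] by (metis add.assoc exponent_sum_Cons mod_add_left_eq)
  ultimately show ?case by simp
qed simp

text \<open>
  The parent of a vertex is found by lowering its last nonzero coordinate, which removes the last letter
  of the monomial.
\<close>

lemma monomial_parent:
  assumes q: "q \<in> torus" "q \<noteq> origin"
  shows "\<exists>p\<in>torus. \<exists>i\<in>{..<n}. monomial n q = monomial n p @ [(i, True)]"
proof -
  let ?I = "{i. i < n \<and> q i \<noteq> 0}"
  have "?I \<noteq> {}"
  proof
    assume "?I = {}"
    then have "q = origin"
      using q(1) origin_in_torus by (intro torus_eqI) (auto simp: origin_def)
    then show False using q(2) by simp
  qed
  then have i: "Max ?I \<in> ?I" by (intro Max_in) auto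
  define i where "i = Max ?I"
  have i: "i < n" "q i \<noteq> 0" using i by (auto simp: i_def)
  have zero: "q j = 0" if "i < j" "j < n" for j
  proof (rule ccontr)
    assume "q j \<noteq> 0"
    then have "j \<le> i" using that unfolding i_def by (intro Max_ge) auto
    then show False using that by simp
  qed
  define p where "p = q(i := q i - 1)"
  have "p \<in> torus" using q i by (auto simp: p_def torus_def PiE_iff extensional_def less_imp_diff_less)
  moreover have "monomial n q = monomial n p @ [(i, True)]"
  proof -
    have "[0..<n] = [0..<i] @ i # [Suc i..<n]"
      using i(1) by (metis append_Cons le_add_diff_inverse less_imp_le upt_add_eq_append upt_conv_Cons zero_le)
    then have form: "monomial n f = concat (map (\<lambda>j. replicate (f j) (j, True)) [0..<i]) @ replicate (f i) (i, True)"
      if "\<And>j. i < j \<Longrightarrow> j < n \<Longrightarrow> f j = 0" for f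
      using that by (simp add: monomial_def Suc_le_eq)
    have "map (\<lambda>j. replicate (p j) (j, True)) [0..<i] = map (\<lambda>j. replicate (q j) (j, True)) [0..<i]"
      by (simp add: p_def)
    moreover have "replicate (q i) (i, True) = replicate (p i) (i, True) @ [(i, True)]"
      using i(2) by (cases "q i") (simp_all add: p_def replicate_append_same)
    moreover have "p j = 0" if "i < j" "j < n" for j
      using zero that by (simp add: p_def)
    ultimately show ?thesis
      using form[of q, OF zero] form[of p] by (simp only: append_assoc)
  qed
  ultimately show ?thesis using i by blast
qed

sublocale schreier_graph "{..<n}" torus translate origin "monomial n"
proof
  fix q and a :: "nat letter" assume q: "q \<in> torus" and a: "fst a \<in> {..<n}"
  show "translate q a \<in> torus" by (rule translate_closed[OF q a])
  show "translate (translate q a) (inv_letter a) = q"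
  proof (rule torus_eqI)
    fix k assume "k < n"
    have "int (translate (translate q a) (inv_letter a) k) mod int r
        = (int (q k) + exponent_sum [a] k + exponent_sum [inv_letter a] k) mod int r"
      using translate_mod[of q a k] translate_mod[of "translate q a" "inv_letter a" k]
      by (metis mod_add_left_eq)
    then show "int (translate (translate q a) (inv_letter a) k) mod int r = int (q k) mod int r"
      by (cases a) (auto simp: exponent_sum_letter inv_letter_def)
  qed (use q a in \<open>simp_all add: translate_closed\<close>)
next
  fix q assume q: "q \<in> torus"
  have w: "fst ` set (monomial n q) \<subseteq> {..<n}"
    using monomial_closed[of n q] by (simp add: free_group_carrier_iff)
  show "foldl translate origin (monomial n q) = q"
    using walk_torus[OF origin_in_torus w] q
    by (intro torus_eqI) (auto simp: exponent_sum_monomial origin_def)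
qed (auto simp: origin_in_torus monomial_closed monomial_parent, simp add: monomial_def origin_def)

lemma stabilizer_eq_N: "stabilizer = N"
proof -
  have "foldl translate origin w = origin \<longleftrightarrow> (\<forall>k<n. int r dvd exponent_sum w k)"
    if w: "w \<in> carrier F" for w
  proof -
    have torus: "foldl translate origin w \<in> torus"
      using walk_torus[OF origin_in_torus, of w] w by (simp add: free_group_carrier_iff)
    have W: "int (foldl translate origin w k) mod int r = exponent_sum w k mod int r" if "k < n" for k
      using walk_torus[OF origin_in_torus, of w] w that
      by (auto simp: free_group_carrier_iff origin_def)
    show ?thesis
    proof
      assume "foldl translate origin w = origin"
      then show "\<forall>k<n. int r dvd exponent_sum w k"
        using W by (auto simp: origin_def dvd_eq_mod_eq_0)
    next
      assume *: "\<forall>k<n. int r dvd exponent_sum w k"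
      show "foldl translate origin w = origin"
        using torus origin_in_torus
        by (rule torus_eqI) (use W * in \<open>auto simp: origin_def dvd_eq_mod_eq_0\<close>)
    qed
  qed
  then show ?thesis by (auto simp: stabilizer_def N_def)
qed

lemma card_torus: "card torus = r ^ n"
  by (simp add: torus_def card_funcsetE)

lemma N_free:
  assumes "m = r ^ n * (n - 1) + 1"
  shows "\<exists>i. i \<in> hom (free_group {..<m}) F \<and> inj_on i (carrier (free_group {..<m}))
    \<and> i ` carrier (free_group {..<m}) = N"
proof -
  have "finite torus" by (simp add: torus_def finite_PiE)
  moreover have "{..<n} \<noteq> {}" using n by (simp add: lessThan_empty_iff)
  ultimately show ?thesis
    using stabilizer_free by (simp add: assms card_torus stabilizer_eq_N)
qed

lemma N_normal: "N \<lhd> F"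
  unfolding F.normal_inv_iff
proof (intro conjI ballI)
  show "subgroup N F" using stabilizer_subgroup by (simp add: stabilizer_eq_N)
  fix x h assume "x \<in> carrier F" "h \<in> N"
  then show "x \<otimes>\<^bsub>F\<^esub> h \<otimes>\<^bsub>F\<^esub> inv\<^bsub>F\<^esub> x \<in> N" by (simp add: N_def exponent_sum_conj)
qed

lemma N_characteristic:
  assumes "\<phi> \<in> auto F"
  shows "\<phi> ` N = N"
proof -
  have sub: "\<psi> w \<in> N" if "\<psi> \<in> auto F" "w \<in> N" for \<psi> w
    using that hom_in_carrier[OF auto_hom[OF that(1)]]
    by (auto simp: N_def exponent_sum_hom[OF auto_hom[OF that(1)]] intro!: dvd_sum dvd_mult)
  show ?thesis
  proof (intro equalityI subsetI)
    fix w assume w: "w \<in> N"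
    then have "w = \<phi> (inv_auto \<phi> w)" using inv_auto_apply[OF assms] by (simp add: N_def)
    then show "w \<in> \<phi> ` N" using sub[OF inv_auto_closed[OF assms] w] by blast
  qed (use sub[OF assms] in auto)
qed

lemma centralizer_N_trivial:
  assumes "g \<in> carrier F" and comm: "\<And>w. w \<in> N \<Longrightarrow> g \<otimes>\<^bsub>F\<^esub> w = w \<otimes>\<^bsub>F\<^esub> g"
  shows "g = \<one>\<^bsub>F\<^esub>"
proof (rule free_group_commutes_with_powers_trivial[OF assms(1)])
  show "0 \<in> {..<n}" "1 \<in> {..<n}" "(0::nat) \<noteq> 1" "0 < r" using n r by auto
  fix z b assume "z \<in> {..<n}"
  then have "replicate r (z, b) \<in> N"
    by (auto simp: N_def free_group_carrier_iff exponent_sum_replicate intro!: reduced_if_constant_sign[of _ b])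
  then show "g \<otimes>\<^bsub>F\<^esub> replicate r (z, b) = replicate r (z, b) \<otimes>\<^bsub>F\<^esub> g" by (rule comm)
qed

text \<open>
  A subgroup although \<open>trace_cocycle\<close> is only a crossed homomorphism, because \<open>Aut F\<close> preserves the
  vectors divisible by \<open>r\<close>.
\<close>

definition K :: "(nat letter list \<Rightarrow> nat letter list) set"
  where "K = {\<phi> \<in> auto F. \<forall>k<n. int r dvd trace_cocycle \<phi> k}"

lemma K_subgroup: "subgroup K (AutoGroup F)"
proof (rule AutF.subgroupI)
  show "K \<subseteq> carrier (AutoGroup F)" by (auto simp: K_def)
  have "\<one>\<^bsub>AutoGroup F\<^esub> \<in> K"
    using AutF.one_closed by (simp add: K_def one_AutoGroup trace_cocycle_id)
  then show "K \<noteq> {}" by blast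
  fix \<phi> assume \<phi>: "\<phi> \<in> K"
  then have \<phi>a: "\<phi> \<in> auto F" by (simp add: K_def)
  have "int r dvd trace_cocycle (inv_auto \<phi>) k" if "k < n" for k
  proof -
    have "trace_cocycle (inv_auto \<phi>) k + (\<Sum>p<n. jac (inv_auto \<phi>) k p * trace_cocycle \<phi> p) = 0"
      using trace_cocycle_compose[OF inv_auto_closed[OF \<phi>a] \<phi>a, of k] that
      by (simp only: compose_inv_auto[OF \<phi>a] trace_cocycle_id)
    moreover have "int r dvd (\<Sum>p<n. jac (inv_auto \<phi>) k p * trace_cocycle \<phi> p)"
      using \<phi> by (intro dvd_sum) (simp add: K_def)
    ultimately show ?thesis by (metis dvd_0_right dvd_add_left_iff)
  qed
  then show "inv\<^bsub>AutoGroup F\<^esub> \<phi> \<in> K"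
    using inv_auto_closed[OF \<phi>a] by (simp add: K_def inv_auto_def)
  fix \<psi> assume \<psi>: "\<psi> \<in> K"
  then have "\<phi> \<otimes>\<^bsub>AutoGroup F\<^esub> \<psi> \<in> auto F"
    using \<phi>a AutF.m_closed[of \<phi> \<psi>] by (simp add: K_def)
  moreover have "int r dvd trace_cocycle (compose (carrier F) \<phi> \<psi>) k" if "k < n" for k
    using \<phi> \<psi> that by (auto simp: K_def trace_cocycle_compose intro!: dvd_add dvd_sum)
  ultimately show "\<phi> \<otimes>\<^bsub>AutoGroup F\<^esub> \<psi> \<in> K"
    using \<phi> \<psi> by (simp add: K_def mult_AutoGroup)
qed

text \<open>
  Composing with conjugation by \<open>g\<close> adds \<open>(n - 1) [g]\<close> to the cocycle, since conjugations act trivially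
  on \<open>H\<close>. With \<open>u\<close> an inverse of \<open>n - 1\<close> modulo \<open>r\<close>, the class \<open>[g] = - u \<kappa>(\<phi>)\<close> therefore makes it
  vanish modulo \<open>r\<close>.
\<close>

lemma K_meets_every_outer_class:
  assumes cop: "coprime r (n - 1)" and \<phi>: "\<phi> \<in> auto F"
  shows "\<exists>g\<in>carrier F. compose (carrier F) (F.conj_by g) \<phi> \<in> K"
proof -
  have "coprime (int n - 1) (int r)"
    using cop n by (metis coprime_commute coprime_int_iff int_ops(2) le_trans of_nat_diff one_le_numeral)
  \<comment> \<open>Modulo \<open>r\<close> the integer \<open>u\<close> is an inverse of \<open>n - 1\<close>.\<close>
  then obtain u v where uv: "u * (int n - 1) + v * int r = 1"
    using bezout_int[of "int n - 1" "int r"] by auto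
  define g where "g = monomial n (\<lambda>k. nat ((- u * trace_cocycle \<phi> k) mod int r))"
  have g: "g \<in> carrier F" unfolding g_def by (rule monomial_closed)
  note g_auto = F.conj_by_auto[OF g]
  have "int r dvd trace_cocycle (compose (carrier F) (F.conj_by g) \<phi>) k" if k: "k < n" for k
  proof -
    let ?c = "trace_cocycle \<phi> k"
    have "(\<Sum>p<n. jac (F.conj_by g) k p * trace_cocycle \<phi> p) = (\<Sum>p<n. if k = p then trace_cocycle \<phi> p else 0)"
      by (intro sum.cong refl) (simp add: jac_conj[OF g])
    then have "trace_cocycle (compose (carrier F) (F.conj_by g) \<phi>) k = (int n - 1) * exponent_sum g k + ?c"
      using k by (simp add: trace_cocycle_compose[OF g_auto \<phi>] trace_cocycle_conj[OF g] del: restrict_apply)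
    moreover have "exponent_sum g k = (- u * ?c) mod int r"
      using k r by (simp add: g_def exponent_sum_monomial)
    then have "int r dvd exponent_sum g k + u * ?c"
      using mod_eq_dvd_iff[of "exponent_sum g k" "int r" "- u * ?c"] by simp
    then have "int r dvd (int n - 1) * (exponent_sum g k + u * ?c) + v * int r * ?c"
      by (intro dvd_add) simp_all
    moreover have "(int n - 1) * (exponent_sum g k + u * ?c) + v * int r * ?c
        = (int n - 1) * exponent_sum g k + (u * (int n - 1) + v * int r) * ?c"
      by (simp add: algebra_simps)
    ultimately show ?thesis by (simp add: uv)
  qed
  moreover have "compose (carrier F) (F.conj_by g) \<phi> \<in> auto F"
    using AutF.m_closed[of "F.conj_by g" \<phi>] g_auto \<phi> by (simp add: mult_AutoGroup del: restrict_apply)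
  ultimately show ?thesis using g by (auto simp: K_def simp del: restrict_apply)
qed

lemma inner_in_K:
  assumes cop: "coprime r (n - 1)" and g: "g \<in> carrier F" and K: "F.conj_by g \<in> K"
  shows "g \<in> N"
proof -
  have cop': "coprime (int r) (int n - 1)"
    using cop n by (metis coprime_int_iff int_ops(2) le_trans of_nat_diff one_le_numeral)
  have "int r dvd exponent_sum g k" if "k < n" for k
  proof -
    have "int r dvd trace_cocycle (F.conj_by g) k" using K that by (simp add: K_def)
    then have "int r dvd (int n - 1) * exponent_sum g k" by (simp only: trace_cocycle_conj[OF g that])
    then show ?thesis using cop' by (simp add: coprime_dvd_mult_right_iff)
  qed
  then show ?thesis using g by (simp add: N_def)
qed

end

theorem corollary1:
  fixes n r m :: nat
  assumes "n \<ge> 2" and "r > 1" and "coprime r (n - 1)"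
    and "m = r ^ n * (n - 1) + 1"
  shows "\<exists>h. h \<in> hom (Out (free_group {..<n})) (Out (free_group {..<m}))
             \<and> inj_on h (carrier (Out (free_group {..<n})))"
proof -
  interpret abelian_cover n r using assms by unfold_locales
  obtain i where i: "i \<in> hom (free_group {..<m}) F" "inj_on i (carrier (free_group {..<m}))"
    "i ` carrier (free_group {..<m}) = N"
    using N_free[OF assms(4)] by blast
  show ?thesis
  proof (rule F.Out_embeds_if_splitting_over_subgroup)
    show "Group.group (free_group {..<m})" by (rule group_free_group)
    show "i \<in> hom (free_group {..<m}) F" by (rule i)
    show "inj_on i (carrier (free_group {..<m}))" by (rule i)
    show "subgroup K (AutoGroup F)" by (rule K_subgroup)
    show "i ` carrier (free_group {..<m}) \<lhd> F" using N_normal by (simp only: i)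
    show "\<phi> ` (i ` carrier (free_group {..<m})) = i ` carrier (free_group {..<m})" if "\<phi> \<in> K" for \<phi>
      unfolding i using that by (intro N_characteristic) (simp add: K_def)
    show "\<exists>g\<in>carrier F. compose (carrier F) (F.conj_by g) \<phi> \<in> K" if "\<phi> \<in> auto F" for \<phi>
      by (rule K_meets_every_outer_class[OF assms(3) that])
    show "g \<in> i ` carrier (free_group {..<m})" if "g \<in> carrier F" "F.conj_by g \<in> K" for g
      unfolding i by (rule inner_in_K[OF assms(3) that])
    show "g = \<one>\<^bsub>F\<^esub>" if "g \<in> carrier F"
      "\<And>x. x \<in> i ` carrier (free_group {..<m}) \<Longrightarrow> g \<otimes>\<^bsub>F\<^esub> x = x \<otimes>\<^bsub>F\<^esub> g" for g
      using that unfolding i by (rule centralizer_N_trivial)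
  qed
qed

end
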